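(* Let $n\geq 15$ with $n\equiv 3\pmod 4$ and $r=4$. Let $V=\{x_1,\dots,x_{n-7}\}\sqcup\{y_1,\dots,y_7\}$ and consider the labelled graph on $V$ with edges: for $1\leq s\leq n-13$, $\{x_s,x_{s+1}\}$ with label $0$ if $s$ is odd and $1$ if $s$ is even; $\{x_{n-12},x_{n-11}\}$ with the two labels $0$ and $2$; $\{x_{n-11},x_{n-10}\}$ with label $1$; $\{x_{n-10},x_{n-9}\}$ with label $2$; $\{x_{n-9},x_{n-8}\}$ with label $1$; $\{x_{n-8},x_{n-7}\}$ with label $2$; $\{y_s,y_{s+1}\}$ for $1\leq s\leq 6$ with label $2$ if $s$ is odd and $1$ if $s$ is even; and $\{x_{n-9},y_2\}$, $\{x_{n-8},y_3\}$ with label $3$. Then $G\cong A_n$ and $(G,(\rho_0,\rho_1,\rho_2,\rho_3))$ is a string C-group of rank 4, with Schläfli type $\{10,7,4\}$ if $n=15$ and $\{2(n-10),14,4\}$ if $n>15$.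
   Context: A string group generated by involutions (sggi) of rank $r$ is a pair $(G,(\rho_0,\dots,\rho_{r-1}))$ where $\rho_0,\dots,\rho_{r-1}$ are involutions generating the group $G$ such that $(\rho_i\rho_j)^2=1$ whenever $|i-j|\geq 2$. It is a string C-group if in addition it satisfies the intersection property: for all $J,K\subseteq\{0,\dots,r-1\}$, $\langle \rho_j : j\in J\rangle\cap\langle\rho_k : k\in K\rangle=\langle \rho_j : j\in J\cap K\rangle$. The Schläfli type is $\{p_1,\dots,p_{r-1}\}$ where $p_i$ is the order of $\rho_{i-1}\rho_i$. Labelled-graph convention: the vertex set $V$ is finite, and each edge $\{a,b\}$ ($a\neq b$) carries one or more labels from $\{0,\dots,r-1\}$, the edges carrying any given label being pairwise disjoint; $\rho_k$ denotes the permutation of $V$ equal to the product of the transpositions $(a\,b)$ over all edges $\{a,b\}$ carrying label $k$, and $G=\langle\rho_0,\dots,\rho_{r-1}\rangle\leq \mathrm{Sym}(V)$. *)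

theory Defs
  imports "HOL-Algebra.Algebra"
begin

definition sggi :: "('a, 'b) monoid_scheme \<Rightarrow> nat \<Rightarrow> (nat \<Rightarrow> 'a) \<Rightarrow> bool" where
  "sggi G r \<rho> \<longleftrightarrow> group G
     \<and> (\<forall>i<r. \<rho> i \<in> carrier G \<and> \<rho> i \<noteq> \<one>\<^bsub>G\<^esub> \<and> \<rho> i \<otimes>\<^bsub>G\<^esub> \<rho> i = \<one>\<^bsub>G\<^esub>)
     \<and> generate G (\<rho> ` {..<r}) = carrier G
     \<and> (\<forall>i<r. \<forall>j<r. (i + 2 \<le> j \<or> j + 2 \<le> i) \<longrightarrow>
          (\<rho> i \<otimes>\<^bsub>G\<^esub> \<rho> j) [^]\<^bsub>G\<^esub> (2::nat) = \<one>\<^bsub>G\<^esub>)"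

definition string_C_group :: "('a, 'b) monoid_scheme \<Rightarrow> nat \<Rightarrow> (nat \<Rightarrow> 'a) \<Rightarrow> bool" where
  "string_C_group G r \<rho> \<longleftrightarrow> sggi G r \<rho>
     \<and> (\<forall>J K. J \<subseteq> {..<r} \<longrightarrow> K \<subseteq> {..<r} \<longrightarrow>
          generate G (\<rho> ` J) \<inter> generate G (\<rho> ` K) = generate G (\<rho> ` (J \<inter> K)))"

definition schlafli_type :: "('a, 'b) monoid_scheme \<Rightarrow> nat \<Rightarrow> (nat \<Rightarrow> 'a) \<Rightarrow> nat list" where
  "schlafli_type G r \<rho> = map (\<lambda>i. group.ord G (\<rho> (i - 1) \<otimes>\<^bsub>G\<^esub> \<rho> i)) [1..<r]"

text \<open>A labelled graph is a set of pairs (edge, label); an edge with several labels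
  occurs once per label. rho k swaps the two ends of every edge carrying label k
  (these edges are pairwise disjoint), i.e. it is the product of those transpositions.\<close>

definition label_perm :: "(nat set \<times> nat) set \<Rightarrow> nat \<Rightarrow> nat \<Rightarrow> nat" where
  "label_perm E k v =
     (if \<exists>w. w \<noteq> v \<and> ({v, w}, k) \<in> E then (THE w. w \<noteq> v \<and> ({v, w}, k) \<in> E) else v)"

text \<open>The graph of Theorem 4.11 on V = {1..n}: x_s = s (1 \<le> s \<le> n-7), y_s = n-7+s (1 \<le> s \<le> 7).\<close>

definition thm411_graph :: "nat \<Rightarrow> (nat set \<times> nat) set" where
  "thm411_graph n =
     {({s, s + 1}, if odd s then 0 else 1) | s. 1 \<le> s \<and> s \<le> n - 13}
   \<union> {({n - 12, n - 11}, 0), ({n - 12, n - 11}, 2), ({n - 11, n - 10}, 1),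
      ({n - 10, n - 9}, 2), ({n - 9, n - 8}, 1), ({n - 8, n - 7}, 2)}
   \<union> {({n - 7 + s, n - 7 + (s + 1)}, if odd s then 2 else 1) | s. 1 \<le> s \<and> s \<le> 6}
   \<union> {({n - 9, n - 7 + 2}, 3), ({n - 8, n - 7 + 3}, 3)}"

definition thm411_rho :: "nat \<Rightarrow> nat \<Rightarrow> nat \<Rightarrow> nat" where
  "thm411_rho n k = label_perm (thm411_graph n) k"

definition thm411_group :: "nat \<Rightarrow> (nat \<Rightarrow> nat) monoid" where
  "thm411_group n = (sym_group n)\<lparr> carrier := generate (sym_group n) (thm411_rho n ` {..<4}) \<rparr>"

end

theory Submission
  imports Defs
begin

text \<open>Write \<open>G\<^sub>0 = \<langle>\<rho>\<^sub>1, \<rho>\<^sub>2, \<rho>\<^sub>3\<rangle>\<close> and \<open>G\<^sub>3 = \<langle>\<rho>\<^sub>0, \<rho>\<^sub>1, \<rho>\<^sub>2\<rangle>\<close>. On \<open>y\<^sub>1, \<dots>, y\<^sub>7\<close> the group \<open>G\<^sub>3\<close> acts like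
  \<open>\<langle>\<rho>\<^sub>1, \<rho>\<^sub>2\<rangle>\<close>. The last seven points of the \<open>x\<close>-path, read backwards, form a second copy of the
  \<open>y\<close>-path, and \<open>G\<^sub>0\<close> permutes the seven pairs of corresponding points; on the rest of the path it
  acts trivially or as \<open>\<rho>\<^sub>1\<close>. So an element of \<open>G\<^sub>0 \<inter> G\<^sub>3\<close> agrees on all fourteen points with some
  element of \<open>\<langle>\<rho>\<^sub>1, \<rho>\<^sub>2\<rangle>\<close>, and the quotient is trivial or \<open>(\<rho>\<^sub>1 \<rho>\<^sub>2)\<^sup>7\<close>. The dihedral groups
  \<open>\<langle>\<rho>\<^sub>i, \<rho>\<^sub>j\<rangle>\<close> are intersected directly, and the intersection property follows by induction on the rank.
  All generators are even. Conversely, a suitable conjugate of \<open>\<rho>\<^sub>3\<close> times its conjugate by \<open>\<rho>\<^sub>0\<close> is a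
  3-cycle, and conjugating it along the graph produces all 3-cycles.\<close>

section \<open>Groups generated by involutions\<close>

context group
begin

text \<open>The generators are their own inverses, so every element is a plain product of generators
  and an induction need only multiply by one generator on the left.\<close>

lemma generate_involutions_induct [consumes 2, case_names one mult]:
  assumes x: "x \<in> generate G S"
    and inv: "\<forall>s\<in>S. s \<in> carrier G \<and> s \<otimes> s = \<one>"
    and one: "P \<one>"
    and step: "\<And>s x. s \<in> S \<Longrightarrow> x \<in> generate G S \<Longrightarrow> P x \<Longrightarrow> P (s \<otimes> x)"
  shows "P x"
proof -
  have S: "S \<subseteq> carrier G" using inv by blast
  \<comment> \<open>Strengthened to a claim about left multiplication by \<open>x\<close>, which
    composes in the \<open>eng\<close> case; \<open>y = \<one>\<close> recovers the goal.\<close>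
  have "\<forall>y \<in> generate G S. P y \<longrightarrow> P (x \<otimes> y)"
    using x
  proof induction
    case one
    then show ?case using generate_in_carrier[OF S] by simp
  next
    case (incl h)
    then show ?case using step by blast
  next
    case (inv h)
    then have "inv h = h" using assms(2) inv_equality by blast
    with inv show ?case using step by simp
  next
    case (eng h k)
    show ?case
    proof (intro ballI impI)
      fix y assume y: "y \<in> generate G S" "P y"
      have "h \<otimes> k \<otimes> y = h \<otimes> (k \<otimes> y)"
        using eng.hyps y generate_in_carrier[OF S] by (simp add: m_assoc)
      moreover have "k \<otimes> y \<in> generate G S" using eng.hyps y by (simp add: generate.eng)
      ultimately show "P (h \<otimes> k \<otimes> y)" using eng.IH y by simp
    qed
  qed
  then have "P (x \<otimes> \<one>)" using one generate.one by blast
  then show ?thesis using generate_in_carrier[OF S x] by simp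
qed

lemma generate_commute:
  assumes inv: "\<forall>s\<in>A. s \<in> carrier G \<and> s \<otimes> s = \<one>"
    and b: "b \<in> carrier G" and comm: "\<And>a. a \<in> A \<Longrightarrow> a \<otimes> b = b \<otimes> a"
    and a: "a \<in> generate G A"
  shows "a \<otimes> b = b \<otimes> a"
  using a inv
proof (induction a rule: generate_involutions_induct)
  case one
  then show ?case using b by simp
next
  case (mult s x)
  have A: "A \<subseteq> carrier G" using inv by blast
  have sx: "s \<in> carrier G" "x \<in> carrier G" using mult inv generate_in_carrier[OF A] by auto
  show ?case using mult.hyps mult.IH comm[of s] sx b by (metis m_assoc)
qed

text \<open>Factors from \<open>A\<close> can be moved to the left past those from \<open>B\<close>.
  This serves to factor an element at a gap in its set of labels.\<close>

lemma generate_Un_commuting: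
  assumes invA: "\<forall>s\<in>A. s \<in> carrier G \<and> s \<otimes> s = \<one>"
    and invB: "\<forall>s\<in>B. s \<in> carrier G \<and> s \<otimes> s = \<one>"
    and comm: "\<And>a b. a \<in> A \<Longrightarrow> b \<in> B \<Longrightarrow> a \<otimes> b = b \<otimes> a"
    and g: "g \<in> generate G (A \<union> B)"
  shows "\<exists>a \<in> generate G A. \<exists>b \<in> generate G B. g = a \<otimes> b"
proof -
  have A: "A \<subseteq> carrier G" and B: "B \<subseteq> carrier G" using invA invB by blast+
  have inv: "\<forall>s\<in>A \<union> B. s \<in> carrier G \<and> s \<otimes> s = \<one>" using invA invB by blast
  from g inv show ?thesis
  proof (induction g rule: generate_involutions_induct)
    case one
    then show ?case using generate.one l_one[OF one_closed] by metis
  next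
    case (mult s x)
    then obtain a b where ab: "a \<in> generate G A" "b \<in> generate G B" "x = a \<otimes> b" by blast
    have c: "a \<in> carrier G" "b \<in> carrier G" "s \<in> carrier G"
      using ab generate_in_carrier A B mult.hyps by auto
    show ?case
    proof (cases "s \<in> A")
      case True
      have "s \<otimes> x = (s \<otimes> a) \<otimes> b" using c ab by (simp add: m_assoc)
      then show ?thesis using True ab generate.eng generate.incl by metis
    next
      case False
      then have s: "s \<in> B" using mult by blast
      have "a \<otimes> s = s \<otimes> a"
        by (rule generate_commute[of A]) (use invA c comm s ab in auto)
      then have "s \<otimes> x = a \<otimes> (s \<otimes> b)" using c ab by (metis m_assoc)
      then show ?thesis using s ab generate.eng generate.incl by metis
    qed
  qed
qed

section \<open>The intersection property on intervals of labels\<close>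

text \<open>Taken relative to a set of labels, so that it also speaks of parabolic subgroups. Only
  one inclusion is demanded, since the other is monotonicity of \<open>generate\<close>.\<close>

definition intersection_property :: "(nat \<Rightarrow> 'a) \<Rightarrow> nat set \<Rightarrow> bool" where
  "intersection_property \<rho> S \<longleftrightarrow> (\<forall>J K. J \<subseteq> S \<longrightarrow> K \<subseteq> S \<longrightarrow>
     generate G (\<rho> ` J) \<inter> generate G (\<rho> ` K) \<subseteq> generate G (\<rho> ` (J \<inter> K)))"

lemma intersection_propertyD:
  assumes "intersection_property \<rho> S" "J \<subseteq> S" "K \<subseteq> S"
    "x \<in> generate G (\<rho> ` J)" "x \<in> generate G (\<rho> ` K)"
  shows "x \<in> generate G (\<rho> ` (J \<inter> K))"
  using assms unfolding intersection_property_def by blast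

lemma intersection_property_singleton: "intersection_property \<rho> {i}"
  unfolding intersection_property_def
proof (intro allI impI)
  fix J K assume "J \<subseteq> {i}" "K \<subseteq> {i}"
  then consider "J \<inter> K = J" | "J \<inter> K = K" by blast
  then show "generate G (\<rho> ` J) \<inter> generate G (\<rho> ` K) \<subseteq> generate G (\<rho> ` (J \<inter> K))"
    by cases auto
qed

text \<open>The usual inductive criterion for string C-groups: the property passes from the two end
  parabolics to the whole group once these meet in the parabolic of the interior labels. A proper
  subset of labels misses either an end, where the hypotheses apply, or an interior label, where its
  elements factor.\<close>

proposition intersection_property_interval:
  fixes \<rho> :: "nat \<Rightarrow> 'a" and l u :: nat
  assumes lu: "l < u"
    and inv: "\<And>i. i \<in> {l..u} \<Longrightarrow> \<rho> i \<in> carrier G \<and> \<rho> i \<otimes> \<rho> i = \<one>"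
    and comm: "\<And>i j. i \<in> {l..u} \<Longrightarrow> j \<in> {l..u} \<Longrightarrow> i + 2 \<le> j \<Longrightarrow> \<rho> i \<otimes> \<rho> j = \<rho> j \<otimes> \<rho> i"
    and lower: "intersection_property \<rho> {l..<u}"
    and upper: "intersection_property \<rho> {l<..u}"
    and middle: "generate G (\<rho> ` {l..<u}) \<inter> generate G (\<rho> ` {l<..u}) \<subseteq> generate G (\<rho> ` {l<..<u})"
  shows "intersection_property \<rho> {l..u}"
proof -
  define H where "H J = generate G (\<rho> ` J)" for J
  have sg: "subgroup (H J) G" if "J \<subseteq> {l..u}" for J
    unfolding H_def using inv that by (intro generate_is_subgroup) blast
  have mono: "H J \<subseteq> H K" if "J \<subseteq> K" for J K
    unfolding H_def using that by (intro mono_generate) blast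
  have sub: "{l..<u} \<subseteq> {l..u}" "{l<..u} \<subseteq> {l..u}" by auto
  have mono': "x \<in> H K" if "x \<in> H J" "J \<subseteq> K" for x J K
    using mono that by blast
  have car: "x \<in> carrier G" if "J \<subseteq> {l..u}" "x \<in> H J" for x J
    using subgroup.mem_carrier[OF sg[OF that(1)] that(2)] .
  have mul: "x \<otimes> y \<in> H J" if "J \<subseteq> {l..u}" "x \<in> H J" "y \<in> H J" for x y J
    using subgroup.m_closed[OF sg[OF that(1)] that(2,3)] .
  have iv: "inv x \<in> H J" if "J \<subseteq> {l..u}" "x \<in> H J" for x J
    using subgroup.m_inv_closed[OF sg[OF that(1)] that(2)] .
  have split: "\<exists>a\<in>H A. \<exists>b\<in>H B. x = a \<otimes> b"
    if "J \<subseteq> {l..u}" "x \<in> H J" "J = A \<union> B" "\<And>p q. p \<in> A \<Longrightarrow> q \<in> B \<Longrightarrow> p + 2 \<le> q" for J A B x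
    unfolding H_def
  proof (rule generate_Un_commuting)
    show "x \<in> generate G (\<rho> ` A \<union> \<rho> ` B)" using that(2,3) by (simp add: H_def image_Un)
    show "a \<otimes> b = b \<otimes> a" if "a \<in> \<rho> ` A" "b \<in> \<rho> ` B" for a b
      using that \<open>J \<subseteq> {l..u}\<close> \<open>J = A \<union> B\<close> \<open>\<And>p q. p \<in> A \<Longrightarrow> q \<in> B \<Longrightarrow> p + 2 \<le> q\<close> comm
      by (smt (verit) Un_iff imageE subsetD)
    show "\<forall>s\<in>\<rho> ` A. s \<in> carrier G \<and> s \<otimes> s = \<one>"
      using inv \<open>J \<subseteq> {l..u}\<close> \<open>J = A \<union> B\<close> by (metis Un_iff imageE subsetD)
    show "\<forall>s\<in>\<rho> ` B. s \<in> carrier G \<and> s \<otimes> s = \<one>"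
      using inv \<open>J \<subseteq> {l..u}\<close> \<open>J = A \<union> B\<close> by (metis Un_iff imageE subsetD)
  qed
  have low: "x \<in> H (J \<inter> K)" if "J \<subseteq> {l..<u}" "K \<subseteq> {l..<u}" "x \<in> H J" "x \<in> H K" for x J K
    using intersection_propertyD[OF lower] that unfolding H_def by blast
  have upp: "x \<in> H (J \<inter> K)" if "J \<subseteq> {l<..u}" "K \<subseteq> {l<..u}" "x \<in> H J" "x \<in> H K" for x J K
    using intersection_propertyD[OF upper] that unfolding H_def by blast
  \<comment> \<open>\<open>middle\<close> first puts \<open>x\<close> on the interior labels; then
    \<open>upp\<close> cuts down to \<open>J\<close> and \<open>low\<close> to
    \<open>K\<close>.\<close>
  have mid: "x \<in> H (J \<inter> K)" if JK: "J \<subseteq> {l<..u}" "K \<subseteq> {l..<u}" "x \<in> H J" "x \<in> H K" for x J K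
  proof -
    have "x \<in> H {l<..u}" "x \<in> H {l..<u}" using JK mono by blast+
    then have m: "x \<in> H {l<..<u}" using middle unfolding H_def by blast
    have "x \<in> H (J \<inter> {l<..<u})" by (rule upp) (use JK m in auto)
    then have "x \<in> H (J \<inter> {l<..<u} \<inter> K)" using JK by - (rule low; auto)
    then show ?thesis using mono[of "J \<inter> {l<..<u} \<inter> K" "J \<inter> K"] by blast
  qed
  \<comment> \<open>Labels on opposite sides of the missing label \<open>i\<close> differ by at
    least 2, so their generators commute.\<close>
  have gap: "\<exists>a\<in>H (J \<inter> {l..<i}). \<exists>b\<in>H (J \<inter> {i<..u}). x = a \<otimes> b"
    if "J \<subseteq> {l..u}" "i \<notin> J" "x \<in> H J" for x i J
  proof (rule split[OF that(1,3)])
    have "p < i \<or> i < p" if "p \<in> J" for p using that \<open>i \<notin> J\<close> by (metis nat_neq_iff)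
    then show "J = J \<inter> {l..<i} \<union> J \<inter> {i<..u}" using \<open>J \<subseteq> {l..u}\<close> by fastforce
    show "p + 2 \<le> q" if "p \<in> J \<inter> {l..<i}" "q \<in> J \<inter> {i<..u}" for p q
      using that by auto
  qed
  have gap_end: "x \<in> H (J \<inter> K)"
    if J: "J \<subseteq> {l..u}" and K: "K \<subseteq> {l..u}" and e: "l \<notin> K \<or> u \<notin> K" and x: "x \<in> H J" "x \<in> H K" for x J K
  proof -
    have Kc: "K \<subseteq> {l<..u} \<or> K \<subseteq> {l..<u}" using K e
        by (metis atLeastAtMost_iff atLeastLessThan_iff greaterThanAtMost_iff le_neq_implies_less subsetD subsetI)
    have ends: "x \<in> H (J' \<inter> K)" if J': "J' \<subseteq> {l<..u} \<or> J' \<subseteq> {l..<u}" "x \<in> H J'" for J'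
      using Kc J' low[of J' K x] upp[of J' K x] mid[of J' K x] mid[of K J' x] x
      by (auto simp: Int_commute)
    show ?thesis
    proof (cases "l \<in> J \<and> u \<in> J")
      case False
      then have "J \<subseteq> {l<..u} \<or> J \<subseteq> {l..<u}" using J
        by (metis atLeastAtMost_iff atLeastLessThan_iff greaterThanAtMost_iff le_neq_implies_less subsetD subsetI)
      then show ?thesis using ends x by blast
    next
      case luJ: True
      show ?thesis
      proof (cases "J = {l..u}")
        case True
        then have "J \<inter> K = K" using K by blast
        then show ?thesis using x by simp
      next
        case False
        then obtain i where i: "i \<in> {l..u}" "i \<notin> J" using J by blast
        then have li: "l < i" "i < u" using luJ by (metis atLeastAtMost_iff le_neq_implies_less)+
        obtain a b where ab: "a \<in> H (J \<inter> {l..<i})" "b \<in> H (J \<inter> {i<..u})" "x = a \<otimes> b"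
          using gap[OF J i(2) x(1)] by blast
        have c: "a \<in> carrier G" "b \<in> carrier G" using ab car J by (meson le_infI1)+
        show ?thesis
        proof (cases "u \<in> K")
          case False
          then have K': "K \<subseteq> {l..<u}" using K by (auto simp: order.order_iff_strict)
          have "b = inv a \<otimes> x" using c ab by (simp add: m_assoc[symmetric])
          moreover have "a \<in> H {l..<u}" by (rule mono'[OF ab(1)]) (use li in auto)
          moreover have "x \<in> H {l..<u}" using x K' mono by blast
          ultimately have "b \<in> H {l..<u}" using mul[OF sub(1)] iv[OF sub(1)] by simp
          then have "b \<in> H ((J \<inter> {i<..u}) \<inter> {l..<u})" using li ab by - (rule mid; auto)
          then have "b \<in> H (J \<inter> {l..<u})" using mono[of "J \<inter> {i<..u} \<inter> {l..<u}" "J \<inter> {l..<u}"] by blast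
          moreover have "a \<in> H (J \<inter> {l..<u})" by (rule mono'[OF ab(1)]) (use li in auto)
          ultimately have "x \<in> H (J \<inter> {l..<u})" using ab mul[of "J \<inter> {l..<u}"] J by blast
          then have "x \<in> H (J \<inter> {l..<u} \<inter> K)" by - (rule ends; auto)
          then show ?thesis using mono[of "J \<inter> {l..<u} \<inter> K" "J \<inter> K"] by blast
        next
          case True
          then have "l \<notin> K" using e by blast
          then have K': "K \<subseteq> {l<..u}" using K by (auto simp: order.order_iff_strict)
          have "a = x \<otimes> inv b" using c ab by (simp add: m_assoc)
          moreover have "b \<in> H {l<..u}" by (rule mono'[OF ab(2)]) (use li in auto)
          moreover have "x \<in> H {l<..u}" using x K' mono by blast
          ultimately have "a \<in> H {l<..u}" using mul[OF sub(2)] iv[OF sub(2)] by simp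
          then have "a \<in> H ({l<..u} \<inter> (J \<inter> {l..<i}))" using li ab by - (rule mid; auto)
          then have "a \<in> H (J \<inter> {l<..u})" using mono[of "{l<..u} \<inter> (J \<inter> {l..<i})" "J \<inter> {l<..u}"] by blast
          moreover have "b \<in> H (J \<inter> {l<..u})" by (rule mono'[OF ab(2)]) (use li in auto)
          ultimately have "x \<in> H (J \<inter> {l<..u})" using ab mul[of "J \<inter> {l<..u}"] J by blast
          then have "x \<in> H (J \<inter> {l<..u} \<inter> K)" by - (rule ends; auto)
          then show ?thesis using mono[of "J \<inter> {l<..u} \<inter> K" "J \<inter> K"] by blast
        qed
      qed
    qed
  qed
  have gaps: "x \<in> H (J \<inter> K)"
    if J: "J \<subseteq> {l..u}" and K: "K \<subseteq> {l..u}" and x: "x \<in> H J" "x \<in> H K"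
      and ik: "l < i" "i \<le> k" "k < u" "i \<notin> J" "k \<notin> K" for x J K i k
  proof -
    obtain a b where ab: "a \<in> H (J \<inter> {l..<i})" "b \<in> H (J \<inter> {i<..u})" "x = a \<otimes> b"
      using gap[OF J ik(4) x(1)] by blast
    obtain c d where cd: "c \<in> H (K \<inter> {l..<k})" "d \<in> H (K \<inter> {k<..u})" "x = c \<otimes> d"
      using gap[OF K ik(5) x(2)] by blast
    have car4: "a \<in> carrier G" "b \<in> carrier G" "c \<in> carrier G" "d \<in> carrier G"
      using ab cd car J K by (meson le_infI1)+
    \<comment> \<open>Comparing both factorizations of \<open>x\<close>, the quotient of the left
      parts equals that of the right parts, so it only involves labels strictly between
      \<open>i\<close> and \<open>k\<close>.\<close>
    define w where "w = inv c \<otimes> a"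
    have "w \<otimes> b = d" unfolding w_def using car4 ab cd
      by (metis inv_closed inv_solve_left m_assoc m_closed)
    then have w_alt: "w = d \<otimes> inv b" unfolding w_def using car4
      by (metis inv_closed inv_solve_right m_closed)
    have "a \<in> H {l..<k}" "c \<in> H {l..<k}"
      by (rule mono'[OF ab(1)] mono'[OF cd(1)]; use ik in force)+
    then have w1: "w \<in> H {l..<k}" unfolding w_def using ik by (intro mul iv) auto
    have "b \<in> H {i<..u}" "d \<in> H {i<..u}"
      by (rule mono'[OF ab(2)] mono'[OF cd(2)]; use ik in force)+
    then have w2: "w \<in> H {i<..u}" unfolding w_alt using ik by (intro mul iv) auto
    have "w \<in> H ({i<..u} \<inter> {l..<k})" using w1 w2 ik by - (rule mid; auto)
    moreover have "{i<..u} \<inter> {l..<k} = {i<..<k}" using ik by auto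
    ultimately have w: "w \<in> H {i<..<k}" by simp
    \<comment> \<open>Both \<open>?M\<close> and \<open>K \<inter> {l..<k}\<close> avoid
      \<open>u\<close>, so \<open>low\<close> applies to \<open>c\<close> and isolates a factor
      \<open>a'\<close> with labels in \<open>J \<inter> K\<close>.\<close>
    let ?M = "(J \<inter> {l..<i}) \<union> {i<..<k}"
    have M: "?M \<subseteq> {l..<u}" "?M \<subseteq> {l..u}" using ik J by auto
    have "c = a \<otimes> inv w" unfolding w_def using car4
      by (metis inv_closed inv_inv inv_mult_group inv_solve_left m_closed)
    moreover have "a \<in> H ?M" "w \<in> H ?M" using ab(1) w mono[of _ ?M] by blast+
    ultimately have "c \<in> H ?M" using mul[OF M(2)] iv[OF M(2)] by simp
    then have "c \<in> H (?M \<inter> (K \<inter> {l..<k}))" using cd(1) M ik by - (rule low; auto)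
    then obtain a' v where av: "a' \<in> H (J \<inter> K \<inter> {l..<i})" "v \<in> H (K \<inter> {i<..<k})" "c = a' \<otimes> v"
      using split[of "?M \<inter> (K \<inter> {l..<k})" c "J \<inter> K \<inter> {l..<i}" "K \<inter> {i<..<k}"] ik J K by fastforce
    have a': "a' \<in> H J" "a' \<in> H (J \<inter> K)" using av(1) mono by blast+
    have car2: "a' \<in> carrier G" "v \<in> carrier G" using a' av(2) car J K by (meson le_infI1)+
    have eq: "x = a' \<otimes> (v \<otimes> d)" using cd av car2 car4 by (simp add: m_assoc)
    then have "v \<otimes> d = inv a' \<otimes> x" using car2 car4 by (simp add: m_assoc[symmetric])
    then have vdJ: "v \<otimes> d \<in> H J" using mul[OF J] iv[OF J] a' x by simp
    have "v \<in> H (K \<inter> {i<..u})" "d \<in> H (K \<inter> {i<..u})"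
      by (rule mono'[OF av(2)] mono'[OF cd(2)]; use ik in force)+
    then have "v \<otimes> d \<in> H (K \<inter> {i<..u})" using mul K by (meson le_infI1)
    \<comment> \<open>The remaining factor lies in \<open>H J\<close> and uses labels of
      \<open>K\<close> above \<open>i\<close> only. These miss \<open>l\<close>, so
      \<open>gap_end\<close> finishes.\<close>
    then have "v \<otimes> d \<in> H (J \<inter> (K \<inter> {i<..u}))" using vdJ J K ik by - (rule gap_end; auto)
    then have "v \<otimes> d \<in> H (J \<inter> K)" using mono[of "J \<inter> (K \<inter> {i<..u})" "J \<inter> K"] by blast
    then show ?thesis using eq a' mul J by (metis le_infI1)
  qed
  have "x \<in> H (J \<inter> K)" if J: "J \<subseteq> {l..u}" and K: "K \<subseteq> {l..u}" and x: "x \<in> H J" "x \<in> H K" for x J K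
  proof (cases "J = {l..u} \<or> K = {l..u}")
    case True
    then have "J \<inter> K = J \<or> J \<inter> K = K" using J K by blast
    then show ?thesis using x by auto
  next
    case False
    then obtain i k where i: "i \<in> {l..u}" "i \<notin> J" and k: "k \<in> {l..u}" "k \<notin> K" using J K by blast
    consider "l \<notin> K \<or> u \<notin> K" | "l \<notin> J \<or> u \<notin> J" | "l \<in> K" "u \<in> K" "l \<in> J" "u \<in> J" by blast
    then show ?thesis
    proof cases
      case 1 then show ?thesis using gap_end J K x by blast
    next
      case 2 then show ?thesis using gap_end[of K J x] J K x by (simp add: Int_commute)
    next
      case 3
      then have "l < i" "i < u" "l < k" "k < u" using i k by (metis atLeastAtMost_iff le_neq_implies_less)+
      then show ?thesis using gaps[of J K x i k] gaps[of K J x k i] J K x i k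
        by (metis Int_commute linorder_linear)
    qed
  qed
  then show ?thesis unfolding intersection_property_def H_def by blast
qed

end

section \<open>The generators as explicit permutations\<close>

lemma involution_permutes:
  assumes "\<And>v. p (p v) = v" and "\<And>v. v \<notin> S \<Longrightarrow> p v = v"
  shows "p permutes S"
  unfolding permutes_def using assms by metis

text \<open>Replaces the description by \<open>THE\<close> with an explicit function. Pairs with
  \<open>v < w\<close> suffice, because edges are unordered and \<open>f\<close> is an
  involution.\<close>

lemma label_perm_involution:
  assumes inv: "\<And>v. f (f v) = v"
    and edge: "\<And>v w. v < w \<Longrightarrow> ({v, w}, k) \<in> E \<longleftrightarrow> f v = w"
  shows "label_perm E k = f"
proof
  fix v
  have e: "w \<noteq> v \<and> ({v, w}, k) \<in> E \<longleftrightarrow> w \<noteq> v \<and> f v = w" for w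
    using edge[of v w] edge[of w v] inv by (metis doubleton_eq_iff linorder_neqE_nat)
  show "label_perm E k v = f v"
    unfolding label_perm_def e by auto
qed

section \<open>Signs of products of adjacent transpositions\<close>

text \<open>This is the product of the \<open>k\<close> transpositions \<open>(c c+1)\<close>,
  \<open>(c+2 c+3)\<close>, and so on; the parity relative to \<open>c\<close> tells left ends from
  right ends.\<close>

definition pair_swap :: "nat \<Rightarrow> nat \<Rightarrow> nat \<Rightarrow> nat" where
  "pair_swap c k v = (if c \<le> v \<and> v < c + 2 * k then if even v = even c then v + 1 else v - 1 else v)"

lemma pair_swap_Suc: "pair_swap c (Suc k) = transpose (c + 2 * k) (c + 2 * k + 1) \<circ> pair_swap c k"
proof
  fix v
  consider "v < c" | "c + 2 * k + 1 < v" | "v = c + 2 * k" | "v = c + 2 * k + 1" | "c \<le> v" "v < c + 2 * k"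
    by linarith
  then show "pair_swap c (Suc k) v = (transpose (c + 2 * k) (c + 2 * k + 1) \<circ> pair_swap c k) v"
  proof cases
    case 5
    then obtain j where j: "v = c + j" "j < 2 * k" by (metis add_less_cancel_left le_Suc_ex)
    have "Suc j \<noteq> 2 * k" if "even j" using that by presburger
    then show ?thesis using j by (auto simp: pair_swap_def transpose_def)
  qed (auto simp: pair_swap_def transpose_def)
qed

lemma evenperm_pair_swap: "permutation (pair_swap c k) \<and> evenperm (pair_swap c k) = even k"
proof (induction k)
  case 0
  have "pair_swap c 0 = id" by (auto simp: pair_swap_def)
  then show ?case by simp
next
  case (Suc k)
  then show ?case unfolding pair_swap_Suc
    by (metis evenperm_comp evenperm_swap even_Suc n_not_Suc_n Suc_eq_plus1 permutation_compose permutation_swap_id)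
qed

text \<open>With \<open>N = n - 14\<close>, the points \<open>N + 1, \<dots>, N + 7\<close> are \<open>x\<^bsub>n-13\<^esub>, \<dots>, x\<^bsub>n-7\<^esub>\<close>, the points
  \<open>N + 8, \<dots>, N + 14\<close> are \<open>y\<^sub>1, \<dots>, y\<^sub>7\<close>, and \<open>1, \<dots>, N\<close> form the tail of the path.\<close>

locale thm411 =
  fixes N :: nat
  assumes N: "N mod 4 = 1"
begin

text \<open>Since \<open>N\<close> is odd, a single parity test picks the partner of
  \<open>v\<close> along both paths, here and in \<open>r1\<close> and \<open>r2\<close>.\<close>

definition r0 :: "nat \<Rightarrow> nat" where
  "r0 v = (if 1 \<le> v \<and> v \<le> N + 3 then if odd v then v + 1 else v - 1 else v)"

definition r1 :: "nat \<Rightarrow> nat" where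
  "r1 v = (if 2 \<le> v \<and> v \<le> N + 6 \<or> N + 9 \<le> v \<and> v \<le> N + 14 then if even v then v + 1 else v - 1 else v)"

definition r2 :: "nat \<Rightarrow> nat" where
  "r2 v = (if N + 2 \<le> v \<and> v \<le> N + 13 then if odd v then v + 1 else v - 1 else v)"

definition r3 :: "nat \<Rightarrow> nat" where
  "r3 = transpose (N + 5) (N + 9) \<circ> transpose (N + 6) (N + 10)"

lemma odd_N [simp]: "odd N" "N > 0" "Suc 0 \<le> N"
  using N by presburger+

abbreviation \<rho> :: "nat \<Rightarrow> nat \<Rightarrow> nat" where
  "\<rho> \<equiv> thm411_rho (N + 14)"

lemmas r_defs = r0_def r1_def r2_def r3_def

lemma point_cases:
  obtains "v \<le> N" | "v = N + 1" | "v = N + 2" | "v = N + 3" | "v = N + 4" | "v = N + 5" | "v = N + 6" | "v = N + 7"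
  | "v = N + 8" | "v = N + 9" | "v = N + 10" | "v = N + 11" | "v = N + 12" | "v = N + 13" | "v = N + 14" | "N + 14 < v"
proof -
  have "i = 0 \<or> i = 1 \<or> i = 2 \<or> i = 3 \<or> i = 4 \<or> i = 5 \<or> i = 6 \<or> i = 7 \<or> i = 8 \<or> i = 9 \<or> i = 10
    \<or> i = 11 \<or> i = 12 \<or> i = 13 \<or> i = 14" if "i < 15" for i :: nat
    using that by (auto simp: less_Suc_eq numeral_eq_Suc)
  moreover have "v \<le> N \<or> N + 14 < v \<or> (\<exists>i<15. v = N + i)" by presburger
  ultimately consider "v \<le> N" | "N + 14 < v" | "v = N + 0" | "v = N + 1 \<or> v = N + 2 \<or> v = N + 3 \<or> v = N + 4
    \<or> v = N + 5 \<or> v = N + 6 \<or> v = N + 7 \<or> v = N + 8 \<or> v = N + 9 \<or> v = N + 10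
    \<or> v = N + 11 \<or> v = N + 12 \<or> v = N + 13 \<or> v = N + 14" by blast
  then show ?thesis by cases (use that in auto)
qed

lemma r_involution [simp]: "r0 (r0 v) = v" "r1 (r1 v) = v" "r2 (r2 v) = v" "r3 (r3 v) = v"
proof -
  show "r0 (r0 v) = v" by (cases v rule: point_cases) (auto simp: r0_def)
  show "r1 (r1 v) = v" by (cases v rule: point_cases) (auto simp: r1_def elim!: oddE)
  show "r2 (r2 v) = v" by (cases v rule: point_cases) (auto simp: r2_def)
  show "r3 (r3 v) = v" unfolding r3_def by (auto simp: transpose_def)
qed

lemma r_comp_self [simp]: "r0 \<circ> r0 = id" "r1 \<circ> r1 = id" "r2 \<circ> r2 = id" "r3 \<circ> r3 = id"
  by (simp_all add: fun_eq_iff)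

lemma r_permutes: "r0 permutes {1..N+14}" "r1 permutes {1..N+14}" "r2 permutes {1..N+14}" "r3 permutes {1..N+14}"
proof -
  show "r0 permutes {1..N+14}" by (rule involution_permutes) (simp, simp add: r0_def, linarith)
  show "r1 permutes {1..N+14}" by (rule involution_permutes) (simp, simp add: r1_def, linarith)
  show "r2 permutes {1..N+14}" by (rule involution_permutes) (simp, simp add: r2_def, linarith)
  show "r3 permutes {1..N+14}" by (rule involution_permutes) (simp, auto simp: r3_def transpose_def)
qed

text \<open>Orienting edges by \<open>v < w\<close> turns equality of unordered pairs into two
  equations, from which the generators can be read off label by label.\<close>

lemma graph_edge:
  assumes "v < w"
  shows "({v, w}, k) \<in> thm411_graph (N + 14) \<longleftrightarrow>
    w = v + 1 \<and> 1 \<le> v \<and> v \<le> N + 1 \<and> k = (if odd v then 0 else 1) \<or>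
    v = N + 2 \<and> w = N + 3 \<and> (k = 0 \<or> k = 2) \<or> v = N + 3 \<and> w = N + 4 \<and> k = 1 \<or>
    v = N + 4 \<and> w = N + 5 \<and> k = 2 \<or> v = N + 5 \<and> w = N + 6 \<and> k = 1 \<or> v = N + 6 \<and> w = N + 7 \<and> k = 2 \<or>
    w = v + 1 \<and> N + 8 \<le> v \<and> v \<le> N + 13 \<and> k = (if odd v then 2 else 1) \<or>
    v = N + 5 \<and> w = N + 9 \<and> k = 3 \<or> v = N + 6 \<and> w = N + 10 \<and> k = 3"
proof -
  have pair: "{v, w} = {a, b} \<longleftrightarrow> v = a \<and> w = b" if "a < b" for a b
    using assms that by (auto simp: doubleton_eq_iff)
  have 1: "({v, w}, k) \<in> {({s, s + 1}, if odd s then 0 else 1) | s. 1 \<le> s \<and> s \<le> N + 1} \<longleftrightarrow>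
    w = v + 1 \<and> 1 \<le> v \<and> v \<le> N + 1 \<and> k = (if odd v then 0 else 1)"
    by (auto simp: pair)
  have 2: "({v, w}, k) \<in> {({N + 7 + s, N + 7 + (s + 1)}, if odd s then 2 else 1) | s. 1 \<le> s \<and> s \<le> 6} \<longleftrightarrow>
    w = v + 1 \<and> N + 8 \<le> v \<and> v \<le> N + 13 \<and> k = (if odd v then 2 else 1)" (is "?L \<longleftrightarrow> ?R")
  proof
    show "?L \<Longrightarrow> ?R" by (auto simp: pair)
    assume ?R
    then show ?L by (auto simp: pair intro!: exI[of _ "v - (N + 7)"])
  qed
  have n: "N + 14 - 13 = N + 1" "N + 14 - 12 = N + 2" "N + 14 - 11 = N + 3" "N + 14 - 10 = N + 4"
    "N + 14 - 9 = N + 5" "N + 14 - 8 = N + 6" "N + 14 - 7 = N + 7" by simp_all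
  have 3: "({v, w}, k) \<in> {({N + 2, N + 3}, 0), ({N + 2, N + 3}, 2), ({N + 3, N + 4}, 1),
      ({N + 4, N + 5}, 2), ({N + 5, N + 6}, 1), ({N + 6, N + 7}, 2)} \<longleftrightarrow>
    v = N + 2 \<and> w = N + 3 \<and> (k = 0 \<or> k = 2) \<or> v = N + 3 \<and> w = N + 4 \<and> k = 1 \<or>
    v = N + 4 \<and> w = N + 5 \<and> k = 2 \<or> v = N + 5 \<and> w = N + 6 \<and> k = 1 \<or> v = N + 6 \<and> w = N + 7 \<and> k = 2"
    by (auto simp: pair)
  have 4: "({v, w}, k) \<in> {({N + 5, N + 7 + 2}, 3), ({N + 6, N + 7 + 3}, 3)} \<longleftrightarrow>
    v = N + 5 \<and> w = N + 9 \<and> k = 3 \<or> v = N + 6 \<and> w = N + 10 \<and> k = 3"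
    by (auto simp: pair)
  show ?thesis
    unfolding thm411_graph_def n Un_iff 1 2 3 4 by (simp only: disj_assoc)
qed

lemma rho_eq: "\<rho> 0 = r0" "\<rho> 1 = r1" "\<rho> 2 = r2" "\<rho> 3 = r3"
proof -
  have "({v, w}, 0) \<in> thm411_graph (N + 14) \<longleftrightarrow> r0 v = w" if "v < w" for v w
    unfolding graph_edge[OF that] using that
    by (cases v rule: point_cases) (auto simp: r0_def)
  then show "\<rho> 0 = r0" unfolding thm411_rho_def by (intro label_perm_involution) auto
  have "({v, w}, 1) \<in> thm411_graph (N + 14) \<longleftrightarrow> r1 v = w" if "v < w" for v w
    unfolding graph_edge[OF that] using that
    by (cases v rule: point_cases) (auto simp: r1_def)
  then show "\<rho> 1 = r1" unfolding thm411_rho_def by (intro label_perm_involution) auto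
  have "({v, w}, 2) \<in> thm411_graph (N + 14) \<longleftrightarrow> r2 v = w" if "v < w" for v w
    unfolding graph_edge[OF that] using that
    by (cases v rule: point_cases) (auto simp: r2_def)
  then show "\<rho> 2 = r2" unfolding thm411_rho_def by (intro label_perm_involution) auto
  have "({v, w}, 3) \<in> thm411_graph (N + 14) \<longleftrightarrow> r3 v = w" if "v < w" for v w
    unfolding graph_edge[OF that] using that
    by (cases v rule: point_cases) (auto simp: r3_def transpose_def)
  then show "\<rho> 3 = r3" unfolding thm411_rho_def by (intro label_perm_involution) auto
qed

text \<open>The numbers of transpositions are \<open>(N + 3) div 2\<close>,
  \<open>(N + 5) div 2 + 3\<close>, 6 and 2; \<open>N mod 4 = 1\<close> makes the first two
  even.\<close>

lemma r_evenperm: "evenperm r0" "evenperm r1" "evenperm r2" "evenperm r3"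
proof -
  have "r0 = pair_swap 1 ((N + 3) div 2)"
    using odd_N by (auto simp: r0_def pair_swap_def fun_eq_iff)
  moreover have "even ((N + 3) div 2)" using N by presburger
  ultimately show "evenperm r0" using evenperm_pair_swap by simp
  have "r1 = pair_swap 2 ((N + 5) div 2) \<circ> pair_swap (N + 9) 3"
  proof
    fix v
    show "r1 v = (pair_swap 2 ((N + 5) div 2) \<circ> pair_swap (N + 9) 3) v"
      by (cases v rule: point_cases) (auto simp: r1_def pair_swap_def)
  qed
  moreover have "odd ((N + 5) div 2)" using N by presburger
  ultimately show "evenperm r1" by (simp add: evenperm_comp evenperm_pair_swap)
  have "r2 = pair_swap (N + 2) 6"
    using odd_N by (auto simp: r2_def pair_swap_def fun_eq_iff)
  then show "evenperm r2" using evenperm_pair_swap by simp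
  show "evenperm r3" by (simp add: r3_def evenperm_comp permutation_swap_id evenperm_swap)
qed

lemma r_commute: "r0 \<circ> r2 = r2 \<circ> r0" "r0 \<circ> r3 = r3 \<circ> r0" "r1 \<circ> r3 = r3 \<circ> r1"
proof -
  show "r0 \<circ> r2 = r2 \<circ> r0"
  proof
    fix v
    show "(r0 \<circ> r2) v = (r2 \<circ> r0) v"
      by (cases v rule: point_cases) (auto simp: r0_def r2_def)
  qed
  show "r0 \<circ> r3 = r3 \<circ> r0"
  proof
    fix v
    show "(r0 \<circ> r3) v = (r3 \<circ> r0) v"
      by (cases v rule: point_cases) (auto simp: r0_def r3_def transpose_def)
  qed
  show "r1 \<circ> r3 = r3 \<circ> r1"
  proof
    fix v
    show "(r1 \<circ> r3) v = (r3 \<circ> r1) v"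
      by (cases v rule: point_cases) (auto simp: r1_def r3_def transpose_def)
  qed
qed

end

section \<open>The intersections of the parabolic subgroups\<close>

context thm411
begin

abbreviation gen :: "(nat \<Rightarrow> nat) set \<Rightarrow> (nat \<Rightarrow> nat) set" where
  "gen \<equiv> generate (sym_group (N + 14))"

section \<open>Subgroups of the symmetric group generated by some of the involutions\<close>

lemma r_involution_sym_group:
  assumes "s \<in> {r0, r1, r2, r3}"
  shows "s \<in> carrier (sym_group (N + 14)) \<and> s \<otimes>\<^bsub>sym_group (N + 14)\<^esub> s = \<one>\<^bsub>sym_group (N + 14)\<^esub>"
  using assms r_permutes by (auto simp: sym_group_def)

lemma gen_subgroup: "T \<subseteq> {r0, r1, r2, r3} \<Longrightarrow> subgroup (gen T) (sym_group (N + 14))"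
  using r_involution_sym_group by (intro group.generate_is_subgroup sym_group_is_group) blast

lemma gen_permutes: "T \<subseteq> {r0, r1, r2, r3} \<Longrightarrow> x \<in> gen T \<Longrightarrow> x permutes {1..N+14}"
  using subgroup.mem_carrier[OF gen_subgroup] by (simp add: sym_group_carrier)

lemma gen_id: "id \<in> gen T"
  using generate.one[of "sym_group (N + 14)" T] by (simp add: sym_group_one)

lemma gen_comp: "x \<in> gen T \<Longrightarrow> y \<in> gen T \<Longrightarrow> x \<circ> y \<in> gen T"
  using generate.eng[of x "sym_group (N + 14)" T y] by (simp add: sym_group_mult)

lemma gen_incl: "x \<in> T \<Longrightarrow> x \<in> gen T"
  by (rule generate.incl)

lemma gen_funpow: "x \<in> gen T \<Longrightarrow> x ^^ k \<in> gen T"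
  by (induction k) (auto intro: gen_id gen_comp)

lemma gen_mono: "T \<subseteq> Y \<Longrightarrow> x \<in> gen T \<Longrightarrow> x \<in> gen Y"
  using group.mono_generate[OF sym_group_is_group] by blast

lemma gen_inv:
  assumes "T \<subseteq> {r0, r1, r2, r3}" "x \<in> gen T"
  shows "inv' x \<in> gen T"
  using subgroup.m_inv_closed[OF gen_subgroup[OF assms(1)] assms(2)]
    subgroup.mem_carrier[OF gen_subgroup[OF assms(1)] assms(2)] by simp

lemma gen_induct [consumes 1, case_names id comp]:
  assumes "x \<in> gen T"
    and id: "P id" and comp: "\<And>s x. s \<in> T \<Longrightarrow> x \<in> gen T \<Longrightarrow> P x \<Longrightarrow> P (s \<circ> x)"
    and T: "T \<subseteq> {r0, r1, r2, r3}"
  shows "P x"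
  using assms(1)
proof (rule group.generate_involutions_induct[OF sym_group_is_group])
  show "\<forall>s\<in>T. s \<in> carrier (sym_group (N + 14)) \<and> s \<otimes>\<^bsub>sym_group (N + 14)\<^esub> s = \<one>\<^bsub>sym_group (N + 14)\<^esub>"
    using T r_involution_sym_group by blast
qed (simp_all only: sym_group_one sym_group_mult id comp)

text \<open>The pairs \<open>{N + 8 - i, N + 7 + i}\<close> exchanged by \<open>v \<mapsto> 2 N + 15 - v\<close> are blocks of \<open>\<langle>\<rho>\<^sub>1, \<rho>\<^sub>2, \<rho>\<^sub>3\<rangle>\<close>.\<close>

lemma r_mirror:
  assumes s: "s \<in> {r1, r2, r3}" and v: "v \<in> {N+1..N+14}"
  shows "s v \<in> {N+1..N+14} \<and> s (2 * N + 15 - v) = 2 * N + 15 - s v"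
proof -
  have "r1 v \<in> {N+1..N+14} \<and> r1 (2 * N + 15 - v) = 2 * N + 15 - r1 v"
    using v by (cases v rule: point_cases) (simp_all add: r1_def)
  moreover have "r2 v \<in> {N+1..N+14} \<and> r2 (2 * N + 15 - v) = 2 * N + 15 - r2 v"
    using v by (cases v rule: point_cases) (simp_all add: r2_def)
  moreover have "r3 v \<in> {N+1..N+14} \<and> r3 (2 * N + 15 - v) = 2 * N + 15 - r3 v"
    using v by (cases v rule: point_cases) (simp_all add: r3_def transpose_def)
  ultimately show ?thesis using s by blast
qed

lemma gen123_mirror:
  assumes "x \<in> gen {r1, r2, r3}" "v \<in> {N+1..N+14}"
  shows "x v \<in> {N+1..N+14} \<and> x (2 * N + 15 - v) = 2 * N + 15 - x v"
  using assms
proof (induction x rule: gen_induct)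
  case (comp s x)
  then show ?case using r_mirror[of s "x v"] by simp
qed auto

text \<open>\<open>r2\<close> and \<open>r3\<close> fix the tail pointwise and \<open>r1\<close>
  preserves it, so only the parity of the number of factors \<open>r1\<close> matters there.\<close>

lemma gen123_tail:
  assumes "x \<in> gen {r1, r2, r3}"
  shows "(\<forall>v\<le>N. x v = v) \<or> (\<forall>v\<le>N. x v = r1 v)"
  using assms
proof (induction x rule: gen_induct)
  case (comp s x)
  have r1: "r1 v \<le> N" if "v \<le> N" for v
    using that by (cases "v = N") (auto simp: r1_def)
  have "s v = v" if "s \<noteq> r1" "v \<le> N" for v
    using comp.hyps that by (auto simp: r2_def r3_def transpose_def)
  then show ?case using comp.IH r1 by (cases "s = r1") auto
qed auto

lemma gen12_Y:
  assumes "x \<in> gen {r1, r2}" "v \<in> {N+8..N+14}"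
  shows "x v \<in> {N+8..N+14}"
  using assms
proof (induction x rule: gen_induct)
  case (comp s x)
  have "r1 v \<in> {N+8..N+14} \<and> r2 v \<in> {N+8..N+14}" if "v \<in> {N+8..N+14}" for v
    using that by (cases v rule: point_cases) (simp_all add: r1_def r2_def)
  then show ?case using comp by auto
qed auto

text \<open>\<open>r0\<close> fixes the \<open>y\<close>-points, so deleting it from a word does not
  change the action on them.\<close>

lemma gen012_Y:
  assumes "x \<in> gen {r0, r1, r2}"
  shows "\<exists>d\<in>gen {r1, r2}. \<forall>v\<in>{N+8..N+14}. x v = d v"
  using assms
proof (induction x rule: gen_induct)
  case id
  show ?case using gen_id by (intro bexI[of _ id]) auto
next
  case (comp s x)
  then obtain d where d: "d \<in> gen {r1, r2}" "\<forall>v\<in>{N+8..N+14}. x v = d v" by blast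
  show ?case
  proof (cases "s \<in> {r1, r2}")
    case True
    then show ?thesis using d gen_comp[OF gen_incl d(1)] by (intro bexI[of _ "s \<circ> d"]) auto
  next
    case False
    then have "s = r0" using comp by blast
    then have "(s \<circ> x) v = d v" if "v \<in> {N+8..N+14}" for v
      using gen12_Y[OF d(1) that] d(2) that by (simp add: r0_def)
    then show ?thesis using d(1) by blast
  qed
qed auto

lemma r_values:
  "r0 (N + 2) = N + 3" "r0 (N + 3) = N + 2" "r0 (N + 4) = N + 4" "r0 (N + 5) = N + 5" "r0 (N + 6) = N + 6"
  "r0 (N + 7) = N + 7" "r0 (N + 8) = N + 8" "r0 (N + 9) = N + 9" "r0 (N + 10) = N + 10" "r0 (N + 11) = N + 11"
  "r0 (N + 12) = N + 12" "r0 (N + 13) = N + 13" "r0 (N + 14) = N + 14"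
  "r1 (N + 1) = N + 2" "r1 (N + 2) = N + 1" "r1 (N + 3) = N + 4" "r1 (N + 4) = N + 3" "r1 (N + 5) = N + 6"
  "r1 (N + 6) = N + 5" "r1 (N + 7) = N + 7" "r1 (N + 8) = N + 8" "r1 (N + 9) = N + 10" "r1 (N + 10) = N + 9"
  "r1 (N + 11) = N + 12" "r1 (N + 12) = N + 11" "r1 (N + 13) = N + 14" "r1 (N + 14) = N + 13"
  "r2 (N + 1) = N + 1" "r2 (N + 2) = N + 3" "r2 (N + 3) = N + 2" "r2 (N + 4) = N + 5" "r2 (N + 5) = N + 4"
  "r2 (N + 6) = N + 7" "r2 (N + 7) = N + 6" "r2 (N + 8) = N + 9" "r2 (N + 9) = N + 8" "r2 (N + 10) = N + 11"
  "r2 (N + 11) = N + 10" "r2 (N + 12) = N + 13" "r2 (N + 13) = N + 12" "r2 (N + 14) = N + 14"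
  "r3 (N + 1) = N + 1" "r3 (N + 2) = N + 2" "r3 (N + 3) = N + 3" "r3 (N + 4) = N + 4" "r3 (N + 5) = N + 9"
  "r3 (N + 6) = N + 10" "r3 (N + 7) = N + 7" "r3 (N + 8) = N + 8" "r3 (N + 9) = N + 5" "r3 (N + 10) = N + 6"
  "r3 (N + 11) = N + 11" "r3 (N + 12) = N + 12" "r3 (N + 13) = N + 13" "r3 (N + 14) = N + 14"
  by (simp_all add: r_defs transpose_def)

lemma r_outside:
  assumes "N + 14 < v"
  shows "r0 v = v" "r1 v = v" "r2 v = v" "r3 v = v"
  using assms by (simp_all add: r_defs transpose_def)

text \<open>\<open>r1 \<circ> r2\<close> is a 7-cycle on each of the two copies of the
  \<open>y\<close>-path. On the tail it is \<open>r1\<close>, whose odd powers are \<open>r1\<close>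
  again.\<close>

lemma r1_r2_pow7: "((r1 \<circ> r2) ^^ 7) v = (if v \<le> N then r1 v else v)"
proof -
  have pow: "((r1 \<circ> r2) ^^ 7) v = r1 (r2 (r1 (r2 (r1 (r2 (r1 (r2 (r1 (r2 (r1 (r2 (r1 (r2 v)))))))))))))"
    by (simp add: eval_nat_numeral)
  show ?thesis
  proof (cases "v \<le> N")
    case True
    have "r1 u \<le> N" if "u \<le> N" for u
      using that by (cases "u = N") (auto simp: r1_def)
    moreover have "r2 u = u" if "u \<le> N" for u
      using that by (simp add: r2_def)
    ultimately show ?thesis using True unfolding pow by simp
  next
    case False
    have "((r1 \<circ> r2) ^^ 7) v = v"
      unfolding pow by (cases v rule: point_cases) (simp_all only: r_values r_outside False)
    then show ?thesis using False by simp
  qed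
qed

text \<open>The mirror symmetry makes \<open>x\<close> fix the seven opposite points as well, so
  only the action on the tail is left open.\<close>

lemma gen123_fixing_Y:
  assumes x: "x \<in> gen {r1, r2, r3}" and Y: "\<forall>v\<in>{N+8..N+14}. x v = v"
  shows "x = id \<or> x = (r1 \<circ> r2) ^^ 7"
proof -
  have "x v = v" if v: "v > N" for v
  proof -
    consider "v \<in> {N+8..N+14}" | "v \<in> {N+1..N+7}" | "v > N + 14"
      using v by (cases "v \<le> N + 7"; cases "v \<le> N + 14") auto
    then show ?thesis
    proof cases
      case 2
      then have "2 * N + 15 - v \<in> {N+8..N+14}" "2 * N + 15 - v \<in> {N+1..N+14}" by auto
      then have "x (2 * N + 15 - (2 * N + 15 - v)) = 2 * N + 15 - (2 * N + 15 - v)"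
        using gen123_mirror[OF x] Y by metis
      then show ?thesis using 2 by simp
    next
      case 3
      then show ?thesis using gen_permutes[OF _ x] by (simp add: permutes_def)
    qed (use Y in simp)
  qed
  then have "x v = v \<or> v \<le> N" for v using linorder_not_le by blast
  then show ?thesis
    using gen123_tail[OF x] r1_r2_pow7 by (metis (no_types, lifting) ext id_apply)
qed

lemma gen012_Int_gen123:
  assumes "x \<in> gen {r0, r1, r2}" "x \<in> gen {r1, r2, r3}"
  shows "x \<in> gen {r1, r2}"
proof -
  obtain d where d: "d \<in> gen {r1, r2}" "\<forall>v\<in>{N+8..N+14}. x v = d v"
    using gen012_Y[OF assms(1)] by blast
  have dp: "d permutes {1..N+14}" using gen_permutes[OF _ d(1)] by blast
  have d': "inv' d \<in> gen {r1, r2}" using gen_inv[OF _ d(1)] by blast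
  have "inv' d \<circ> x \<in> gen {r1, r2, r3}"
    by (intro gen_comp assms gen_mono[OF _ d']) auto
  moreover have "\<forall>v\<in>{N+8..N+14}. (inv' d \<circ> x) v = v"
    using d dp by (simp add: permutes_inverses)
  ultimately have "inv' d \<circ> x = id \<or> inv' d \<circ> x = (r1 \<circ> r2) ^^ 7"
    by (rule gen123_fixing_Y)
  moreover have "(r1 \<circ> r2) ^^ 7 \<in> gen {r1, r2}"
    by (intro gen_funpow gen_comp gen_incl) simp_all
  ultimately have "inv' d \<circ> x \<in> gen {r1, r2}"
    using gen_id by metis
  then have "d \<circ> (inv' d \<circ> x) \<in> gen {r1, r2}" using d gen_comp by blast
  then show ?thesis using permutes_inv_o[OF dp] by (simp add: o_assoc)
qed

section \<open>Intersections of the dihedral subgroups\<close>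

text \<open>The relation \<open>braid\<close> expresses that \<open>r2 \<circ> r3\<close> has fourth
  power \<open>id\<close>, so the list is that of the dihedral group of order 8.\<close>

lemma gen23_elements:
  assumes "x \<in> gen {r2, r3}"
  shows "x \<in> {id, r2, r3, r2 \<circ> r3, r3 \<circ> r2, r2 \<circ> (r3 \<circ> r2), r3 \<circ> (r2 \<circ> r3), r2 \<circ> (r3 \<circ> (r2 \<circ> r3))}"
  using assms
proof (induction x rule: gen_induct)
  case (comp s x)
  have braid: "r3 \<circ> (r2 \<circ> (r3 \<circ> r2)) = r2 \<circ> (r3 \<circ> (r2 \<circ> r3))"
  proof
    fix v
    show "(r3 \<circ> (r2 \<circ> (r3 \<circ> r2))) v = (r2 \<circ> (r3 \<circ> (r2 \<circ> r3))) v"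
      by (cases v rule: point_cases) (auto simp: r2_def r3_def transpose_def)
  qed
  have canc: "r2 \<circ> (r2 \<circ> y) = y" "r3 \<circ> (r3 \<circ> y) = y" for y :: "nat \<Rightarrow> nat"
    by (simp_all add: fun_eq_iff)
  have braid': "r3 \<circ> (r2 \<circ> (r3 \<circ> (r2 \<circ> r3))) = r2 \<circ> (r3 \<circ> r2)"
    by (simp only: braid[symmetric] canc)
  from comp.hyps(1) show ?case
  proof (elim insertE emptyE)
    assume "s = r2"
    then show ?thesis using comp.IH
      by (elim insertE emptyE) (simp_all only: canc r_comp_self comp_id id_comp insert_iff simp_thms)
  next
    assume "s = r3"
    then show ?thesis using comp.IH
      by (elim insertE emptyE) (simp_all only: canc braid braid' r_comp_self comp_id id_comp insert_iff simp_thms)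
  qed
qed auto

text \<open>Elements of \<open>gen {r1, r2}\<close> keep the \<open>y\<close>-points among
  themselves. Of the eight candidates, all but \<open>id\<close> and \<open>r2\<close> move
  \<open>N + 8\<close> or \<open>N + 9\<close> to an \<open>x\<close>-point.\<close>

lemma gen12_Int_gen23:
  assumes "x \<in> gen {r1, r2}" "x \<in> gen {r2, r3}"
  shows "x \<in> gen {r2}"
proof -
  have "x (N + 8) \<ge> N + 8" "x (N + 9) \<ge> N + 8"
    using gen12_Y[OF assms(1), of "N + 8"] gen12_Y[OF assms(1), of "N + 9"] by auto
  then have "x = id \<or> x = r2"
    using gen23_elements[OF assms(2)]
    by (elim insertE emptyE) (simp_all add: r2_def r3_def transpose_def)
  then show ?thesis using gen_id gen_incl by blast
qed

text \<open>The components of the graph with labels \<open>0\<close> and \<open>1\<close> are the path \<open>1, \<dots>, N + 4\<close>, single edges and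
  points. The map \<open>pos\<close> numbers the vertices of the path modulo \<open>N + 4\<close> in the order in which
  \<open>\<rho>\<^sub>0 \<rho>\<^sub>1\<close> permutes them cyclically.\<close>

definition pos :: "nat \<Rightarrow> int" where
  "pos v = (if even v then int v div 2 - 1 else - ((int v + 1) div 2))"

text \<open>In this numbering \<open>r1\<close> is the reflection about \<open>-1\<close>, the
  number of its fixed point \<open>1\<close>.\<close>

lemma pos_r1:
  assumes "v \<in> {1..N+4}"
  shows "r1 v \<in> {1..N+4}" "pos (r1 v) = - 2 - pos v"
proof -
  have "v \<noteq> N + 4" if "even v" using that by auto
  then show "r1 v \<in> {1..N+4}" "pos (r1 v) = - 2 - pos v"
    using assms by (auto simp: r1_def pos_def elim!: evenE oddE)
qed

text \<open>\<open>r0\<close> is the reflection about \<open>-1/2\<close>. The congruence is needed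
  at the fixed end \<open>N + 4\<close>, where the sum is \<open>- (N + 4)\<close> and not
  0.\<close>

lemma pos_r0:
  assumes "v \<in> {1..N+4}"
  shows "r0 v \<in> {1..N+4}" "int (N + 4) dvd pos (r0 v) + pos v + 1"
proof -
  show "r0 v \<in> {1..N+4}" using assms by (auto simp: r0_def)
  show "int (N + 4) dvd pos (r0 v) + pos v + 1"
  proof (cases "v = N + 4")
    case True
    then have "r0 v = v" by (simp only: r_values)
    moreover obtain m where "N = 2 * m + 1" using odd_N(1) by (elim oddE)
    then have "pos v + pos v + 1 = - int (N + 4)" using True by (simp add: pos_def)
    ultimately have "pos (r0 v) + pos v + 1 = - int (N + 4)" by simp
    then show ?thesis by (metis dvd_minus_iff dvd_refl)
  next
    case False
    then have "pos (r0 v) + pos v + 1 = 0"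
      using assms by (auto simp: r0_def pos_def elim!: evenE oddE)
    then show ?thesis by simp
  qed
qed

text \<open>The values of \<open>pos\<close> lie among \<open>N + 4\<close> consecutive integers, so
  congruent ones are equal; the sign of \<open>pos v\<close> then reveals the parity of
  \<open>v\<close>.\<close>

lemma pos_inject:
  assumes vw: "v \<in> {1..N+4}" "w \<in> {1..N+4}" and dvd: "int (N + 4) dvd pos v - pos w"
  shows "v = w"
proof -
  obtain m where m: "N = 2 * m + 1" using odd_N(1) by (elim oddE)
  have bounds: "- (int m + 3) \<le> pos u \<and> pos u \<le> int m + 1" if u: "u \<in> {1..N+4}" for u
  proof (cases "even u")
    case True
    then obtain w where "u = 2 * w" by (elim evenE)
    then show ?thesis using u m by (simp add: pos_def)
  next
    case False
    then obtain w where "u = 2 * w + 1" by (elim oddE)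
    then show ?thesis using u m by (simp add: pos_def)
  qed
  have "\<bar>pos v - pos w\<bar> < \<bar>int (N + 4)\<bar>"
    using bounds[OF vw(1)] bounds[OF vw(2)] m by linarith
  then have eq: "pos v = pos w"
    using dvd_imp_le_int[OF _ dvd] by (cases "pos v = pos w") auto
  have "v = (if pos v \<ge> 0 then nat (2 * pos v + 2) else nat (- 2 * pos v - 1))" if "v \<ge> 1" for v
    using that by (cases "even v") (auto simp: pos_def elim!: evenE oddE)
  then show ?thesis using vw eq by (metis atLeastAtMost_iff)
qed

text \<open>Both generators are reflections modulo \<open>N + 4\<close>, so every word acts on the
  path as a rotation or a reflection.\<close>

lemma gen01_dihedral:
  assumes "x \<in> gen {r0, r1}"
  shows "\<exists>k. (\<forall>v\<in>{1..N+4}. x v \<in> {1..N+4} \<and> int (N + 4) dvd pos (x v) - pos v - k) \<or>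
    (\<forall>v\<in>{1..N+4}. x v \<in> {1..N+4} \<and> int (N + 4) dvd pos (x v) + pos v - k)"
  using assms
proof (induction x rule: gen_induct)
  case id
  show ?case by (intro exI[of _ 0]) simp
next
  case (comp s x)
  have "\<exists>c. \<forall>v\<in>{1..N+4}. s v \<in> {1..N+4} \<and> int (N + 4) dvd pos (s v) + pos v - c"
  proof (cases "s = r0")
    case True
    then show ?thesis using pos_r0 by (intro exI[of _ "- 1"]) simp
  next
    case False
    then have "s = r1" using comp by blast
    then show ?thesis using pos_r1 by (intro exI[of _ "- 2"]) simp
  qed
  then obtain c where c: "\<And>v. v \<in> {1..N+4} \<Longrightarrow> s v \<in> {1..N+4}"
    "\<And>v. v \<in> {1..N+4} \<Longrightarrow> int (N + 4) dvd pos (s v) + pos v - c" by blast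
  obtain k where "(\<forall>v\<in>{1..N+4}. x v \<in> {1..N+4} \<and> int (N + 4) dvd pos (x v) - pos v - k) \<or>
    (\<forall>v\<in>{1..N+4}. x v \<in> {1..N+4} \<and> int (N + 4) dvd pos (x v) + pos v - k)" using comp.IH by blast
  then show ?case
  proof
    assume x: "\<forall>v\<in>{1..N+4}. x v \<in> {1..N+4} \<and> int (N + 4) dvd pos (x v) - pos v - k"
    have "int (N + 4) dvd pos (s (x v)) + pos v - (c - k)" if "v \<in> {1..N+4}" for v
      using dvd_diff[OF c(2)[of "x v"], of "pos (x v) - pos v - k"] x that by (simp add: algebra_simps)
    then show ?thesis using x c(1) by (intro exI[of _ "c - k"] disjI2) simp
  next
    assume x: "\<forall>v\<in>{1..N+4}. x v \<in> {1..N+4} \<and> int (N + 4) dvd pos (x v) + pos v - k"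
    have "int (N + 4) dvd pos (s (x v)) - pos v - (c - k)" if "v \<in> {1..N+4}" for v
      using dvd_diff[OF c(2)[of "x v"], of "pos (x v) + pos v - k"] x that by (simp add: algebra_simps)
    then show ?thesis using x c(1) by (intro exI[of _ "c - k"] disjI1) simp
  qed
qed auto

lemma gen01_Y:
  assumes "x \<in> gen {r0, r1}"
  shows "(\<forall>v\<in>{N+8..N+14}. x v = v) \<or> (\<forall>v\<in>{N+8..N+14}. x v = r1 v)"
  using assms
proof (induction x rule: gen_induct)
  case (comp s x)
  have "r0 v = v \<and> r0 (r1 v) = r1 v" if "v \<in> {N+8..N+14}" for v
    using gen12_Y[OF gen_incl that, of r1] that by (auto simp: r0_def)
  then show ?case using comp by auto
qed auto

text \<open>The only candidate besides \<open>id\<close> is the seventh power, which fixes all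
  points beyond \<open>N\<close>. A rotation of the path with a fixed point is trivial there, and a
  reflection cannot fix both \<open>N + 4\<close> and \<open>N + 2\<close>.\<close>

lemma gen01_fixing_Y:
  assumes x: "x \<in> gen {r0, r1}" "x \<in> gen {r1, r2}" and Y: "\<forall>v\<in>{N+8..N+14}. x v = v"
  shows "x = id"
proof -
  have "x \<in> gen {r1, r2, r3}" using gen_mono[OF _ x(2)] by blast
  then have "x = id \<or> x = (r1 \<circ> r2) ^^ 7" using gen123_fixing_Y Y by blast
  moreover have "x = id" if x7: "x = (r1 \<circ> r2) ^^ 7"
  proof -
    have big: "x v = v" if "v > N" for v
      using that r1_r2_pow7 x7 by simp
    have dom: "N + 4 \<in> {1..N+4}" "N + 2 \<in> {1..N+4}" by auto
    from gen01_dihedral[OF x(1)] obtain k where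
      "(\<forall>v\<in>{1..N+4}. x v \<in> {1..N+4} \<and> int (N + 4) dvd pos (x v) - pos v - k) \<or>
       (\<forall>v\<in>{1..N+4}. x v \<in> {1..N+4} \<and> int (N + 4) dvd pos (x v) + pos v - k)" by blast
    then show ?thesis
    proof
      assume rot: "\<forall>v\<in>{1..N+4}. x v \<in> {1..N+4} \<and> int (N + 4) dvd pos (x v) - pos v - k"
      have "int (N + 4) dvd k" using bspec[OF rot dom(1)] big[of "N + 4"] by simp
      then have "x v = v" if "v \<in> {1..N+4}" for v
        using pos_inject[of "x v" v] bspec[OF rot that] that dvd_add[of "int (N + 4)" "pos (x v) - pos v - k" k] by simp
      moreover have "x 0 = 0" using gen_permutes[OF _ x(1)] by (simp add: permutes_def)
      ultimately show ?thesis using big by (metis (no_types, lifting) ext atLeastAtMost_iff id_apply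
        less_one linorder_not_le trans_le_add1)
    next
      assume refl: "\<forall>v\<in>{1..N+4}. x v \<in> {1..N+4} \<and> int (N + 4) dvd pos (x v) + pos v - k"
      have "int (N + 4) dvd pos (N + 4) + pos (N + 4) - k" "int (N + 4) dvd pos (N + 2) + pos (N + 2) - k"
        using bspec[OF refl dom(1)] bspec[OF refl dom(2)] big[of "N + 4"] big[of "N + 2"] by simp_all
      then have "int (N + 4) dvd (pos (N + 4) + pos (N + 4) - k) - (pos (N + 2) + pos (N + 2) - k)"
        by (rule dvd_diff)
      \<comment> \<open>The two points have neighbouring numbers, so twice their difference is
        \<open>- 2\<close>, which \<open>N + 4 > 2\<close> does not divide.\<close>
      moreover have "(pos (N + 4) + pos (N + 4) - k) - (pos (N + 2) + pos (N + 2) - k) = - 2"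
        by (simp add: pos_def)
      ultimately have "int (N + 4) dvd 2" by simp
      then have "int (N + 4) \<le> 2" by (rule zdvd_imp_le) simp
      then show ?thesis by simp
    qed
  qed
  ultimately show ?thesis by blast
qed

text \<open>After multiplication by \<open>r1\<close> if necessary, \<open>x\<close> fixes the
  \<open>y\<close>-points.\<close>

lemma gen01_Int_gen12:
  assumes x: "x \<in> gen {r0, r1}" "x \<in> gen {r1, r2}"
  shows "x \<in> gen {r1}"
  using gen01_Y[OF x(1)]
proof
  assume "\<forall>v\<in>{N+8..N+14}. x v = v"
  then show ?thesis using gen01_fixing_Y x gen_id by blast
next
  assume Y: "\<forall>v\<in>{N+8..N+14}. x v = r1 v"
  have "r1 \<circ> x = id"
  proof (rule gen01_fixing_Y)
    show "r1 \<circ> x \<in> gen {r0, r1}" "r1 \<circ> x \<in> gen {r1, r2}"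
      by (rule gen_comp[OF gen_incl x(1)] gen_comp[OF gen_incl x(2)]; simp)+
    show "\<forall>v\<in>{N+8..N+14}. (r1 \<circ> x) v = v" using Y by simp
  qed
  then have "r1 \<circ> (r1 \<circ> x) = r1" by simp
  then have "x = r1" by (simp add: fun_eq_iff)
  then show ?thesis by (simp add: gen_incl)
qed

section \<open>The Schlaefli type\<close>

text \<open>Here \<open>m\<close> is the length of the cycle of \<open>f\<close> through
  \<open>u\<close>, which divides every exponent that returns \<open>u\<close> to itself.\<close>

lemma funpow_fixed_dvd:
  assumes "(f ^^ m) u = u" "\<And>j. 0 < j \<Longrightarrow> j < m \<Longrightarrow> (f ^^ j) u \<noteq> u" "m > 0" "(f ^^ k) u = u"
  shows "m dvd k"
  using assms funpow_mod_eq[of m f u k] by (metis dvd_eq_mod_eq_0 mod_less_divisor neq0_conv)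

lemma involution_funpow:
  assumes "f \<circ> f = id"
  shows "f ^^ q = (if even q then id else f)"
  using assms by (induction q) (auto simp: fun_eq_iff)

lemma funpow_unroll:
  "(f ^^ 1) u = f u" "(f ^^ 2) u = f (f u)" "(f ^^ 3) u = f (f (f u))" "(f ^^ 4) u = f (f (f (f u)))"
  "(f ^^ 5) u = f (f (f (f (f u))))" "(f ^^ 6) u = f (f (f (f (f (f u)))))"
  by (simp_all add: eval_nat_numeral)

text \<open>The product of the reflections about \<open>-1\<close> and \<open>-1/2\<close> is the
  rotation by one step.\<close>

lemma r0_r1_pow_path:
  assumes "v \<in> {1..N+4}"
  shows "((r0 \<circ> r1) ^^ k) v \<in> {1..N+4} \<and> int (N + 4) dvd pos (((r0 \<circ> r1) ^^ k) v) - pos v - int k"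
proof (induction k)
  case (Suc k)
  define u where "u = ((r0 \<circ> r1) ^^ k) v"
  have u: "u \<in> {1..N+4}" "int (N + 4) dvd pos u - pos v - int k" using Suc unfolding u_def by blast+
  have "((r0 \<circ> r1) ^^ Suc k) v = r0 (r1 u)" by (simp add: u_def)
  moreover have "int (N + 4) dvd pos (r0 (r1 u)) + pos (r1 u) + 1" using pos_r0 pos_r1[OF u(1)] by blast
  then have "int (N + 4) dvd (pos (r0 (r1 u)) - pos u - 1) + (pos u - pos v - int k)"
    using u(2) pos_r1[OF u(1)] by (intro dvd_add) simp_all
  moreover have "r0 (r1 u) \<in> {1..N+4}" using pos_r0 pos_r1[OF u(1)] by blast
  ultimately show ?case by (simp only:) (simp add: algebra_simps)
qed (use assms in simp)

lemma r0_r1_pow_off_path: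
  assumes "v \<notin> {1..N+4}"
  shows "((r0 \<circ> r1) ^^ k) v = (if even k then v else r1 v)"
proof (induction k)
  case (Suc k)
  have "r1 v \<notin> {1..N+4}" using pos_r1(1)[of "r1 v"] assms by auto
  then have "r0 v = v" "r0 (r1 v) = r1 v" using assms by (auto simp: r0_def)
  then show ?case using Suc by simp
qed simp

text \<open>The path is one cycle of odd length \<open>N + 4\<close>; off the path the product acts
  as \<open>r1\<close>, which swaps \<open>N + 5\<close> and \<open>N + 6\<close>. Hence the factor
  2.\<close>

lemma r0_r1_pow_eq_id: "(r0 \<circ> r1) ^^ k = id \<longleftrightarrow> 2 * (N + 4) dvd k"
proof
  assume id: "(r0 \<circ> r1) ^^ k = id"
  have "(if even k then N + 5 else r1 (N + 5)) = N + 5"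
    using r0_r1_pow_off_path[of "N + 5" k] id by simp
  then have "even k" by (auto simp: r1_def split: if_splits)
  moreover have "int (N + 4) dvd int k"
    using r0_r1_pow_path[of 1 k] id by simp
  then have "N + 4 dvd k" by (metis int_dvd_int_iff)
  ultimately show "2 * (N + 4) dvd k"
    by (intro divides_mult) auto
next
  assume k: "2 * (N + 4) dvd k"
  have "even k" using dvd_mult_left[OF k] .
  have "N + 4 dvd k" using dvd_mult_right[OF k] .
  then have dvd: "int (N + 4) dvd int k" by (metis int_dvd_int_iff)
  show "(r0 \<circ> r1) ^^ k = id"
  proof
    fix v
    show "((r0 \<circ> r1) ^^ k) v = id v"
    proof (cases "v \<in> {1..N+4}")
      case True
      then show ?thesis
        using pos_inject[OF _ True] r0_r1_pow_path[OF True, of k] dvd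
        by (metis diff_add_cancel dvd_add id_apply)
    next
      case False
      then show ?thesis using r0_r1_pow_off_path \<open>even k\<close> by simp
    qed
  qed
qed

text \<open>The seventh power is \<open>r1\<close> on the tail and trivial elsewhere. It is an
  involution unless the tail is the single point \<open>1\<close>, that is, unless
  \<open>N = 1\<close>.\<close>

lemma r1_r2_pow_eq_id: "(r1 \<circ> r2) ^^ k = id \<longleftrightarrow> (if N = 1 then 7 else 14) dvd k"
proof -
  let ?z = "(r1 \<circ> r2) ^^ 7"
  have z2: "?z \<circ> ?z = id"
  proof
    fix v
    have "r1 v \<le> N" if "v \<le> N" using that by (cases "v = N") (auto simp: r1_def)
    then show "(?z \<circ> ?z) v = id v" by (simp add: r1_r2_pow7)
  qed
  have z1: "?z = id \<longleftrightarrow> N = 1"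
  proof
    assume "?z = id"
    then have "(if 2 \<le> N then r1 2 else 2) = 2" using r1_r2_pow7[of 2] by simp
    then have "N < 2" by (auto simp: r1_def split: if_splits)
    then show "N = 1" using odd_N by linarith
  next
    assume "N = 1"
    then have "r1 v = v" if "v \<le> N" for v using that unfolding r1_def by auto
    then show "?z = id" unfolding fun_eq_iff r1_r2_pow7 by simp
  qed
  have zq: "?z ^^ q = (if even q then id else ?z)" for q
    by (rule involution_funpow[OF z2])
  have 7: "7 dvd k" if "(r1 \<circ> r2) ^^ k = id"
  proof (rule funpow_fixed_dvd[where f = "r1 \<circ> r2" and u = "N + 8"])
    show "((r1 \<circ> r2) ^^ 7) (N + 8) = N + 8" by (simp add: r1_r2_pow7)
    fix j :: nat assume "0 < j" "j < 7"
    then have "j = 1 \<or> j = 2 \<or> j = 3 \<or> j = 4 \<or> j = 5 \<or> j = 6" by linarith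
    then show "((r1 \<circ> r2) ^^ j) (N + 8) \<noteq> N + 8"
      by (elim disjE; (simp only: funpow_unroll o_apply r_values; simp))
  qed (use that in simp_all)
  have pow: "(r1 \<circ> r2) ^^ (7 * q) = id \<longleftrightarrow> even q \<or> N = 1" for q
    unfolding funpow_mult[symmetric] zq using z1 by simp
  have 14: "14 dvd 7 * q \<longleftrightarrow> even q" for q :: nat by presburger
  show ?thesis
  proof (cases "7 dvd k")
    case True
    then obtain q where "k = 7 * q" by (elim dvdE)
    then show ?thesis using pow[of q] 14[of q] by simp
  next
    case False
    moreover have "\<not> 14 dvd k" using False by presburger
    ultimately show ?thesis using 7 by auto
  qed
qed

text \<open>All cycle lengths divide 4, and \<open>N + 8\<close> lies on a cycle of length
  4.\<close>

lemma r2_r3_pow_eq_id: "(r2 \<circ> r3) ^^ k = id \<longleftrightarrow> 4 dvd k"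
proof
  have 4: "((r2 \<circ> r3) ^^ 4) v = v" for v
  proof -
    have "((r2 \<circ> r3) ^^ 4) v = r2 (r3 (r2 (r3 (r2 (r3 (r2 (r3 v)))))))" by (simp add: eval_nat_numeral)
    also have "\<dots> = v"
    proof (cases "v \<le> N")
      case True
      then show ?thesis by (simp add: r2_def r3_def transpose_def)
    next
      case False
      then show ?thesis by (cases v rule: point_cases) (simp_all only: r_values r_outside simp_thms)
    qed
    finally show ?thesis .
  qed
  {
    assume "(r2 \<circ> r3) ^^ k = id"
    show "4 dvd k"
    proof (rule funpow_fixed_dvd[where f = "r2 \<circ> r3" and u = "N + 8"])
      fix j :: nat assume "0 < j" "j < 4"
      then have "j = 1 \<or> j = 2 \<or> j = 3" by linarith
      then show "((r2 \<circ> r3) ^^ j) (N + 8) \<noteq> N + 8"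
        by (elim disjE; (simp only: funpow_unroll o_apply r_values; simp))
    qed (use 4 \<open>(r2 \<circ> r3) ^^ k = id\<close> in simp_all)
  next
    assume "4 dvd k"
    then obtain q where "k = 4 * q" by blast
    moreover have "(r2 \<circ> r3) ^^ 4 = id" using 4 by (simp add: fun_eq_iff)
    ultimately show "(r2 \<circ> r3) ^^ k = id" by (simp add: funpow_mult[symmetric])
  }
qed

end

section \<open>Generating the alternating group\<close>

text \<open>For distinct arguments this is the cycle sending \<open>a\<close> to \<open>b\<close>,
  \<open>b\<close> to \<open>c\<close> and \<open>c\<close> to \<open>a\<close>, in the form that
  \<open>cycle_of_list\<close> gives.\<close>

definition cyc3 :: "'a \<Rightarrow> 'a \<Rightarrow> 'a \<Rightarrow> 'a \<Rightarrow> 'a" where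
  "cyc3 a b c = transpose a b \<circ> transpose b c"

lemma conj_transpose:
  assumes "bij p"
  shows "p \<circ> transpose a b \<circ> inv' p = transpose (p a) (p b)"
proof
  fix v
  obtain w where v: "v = p w" using assms by (metis bij_pointE)
  have "inv' p v = w" using assms unfolding v by (simp add: bij_is_inj)
  moreover have "p x = p y \<longleftrightarrow> x = y" for x y using assms by (simp add: bij_is_inj inj_eq)
  ultimately show "(p \<circ> transpose a b \<circ> inv' p) v = transpose (p a) (p b) v"
    by (simp add: v transpose_def)
qed

lemma conj_cyc3:
  assumes "bij p"
  shows "p \<circ> cyc3 a b c \<circ> inv' p = cyc3 (p a) (p b) (p c)"
proof -
  have "p \<circ> cyc3 a b c \<circ> inv' p = (p \<circ> transpose a b \<circ> inv' p) \<circ> (p \<circ> transpose b c \<circ> inv' p)"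
    using assms by (simp add: fun_eq_iff cyc3_def bij_is_inj)
  then show ?thesis by (simp only: conj_transpose[OF assms] cyc3_def)
qed

lemma cyc3_rotate: "a \<noteq> b \<Longrightarrow> b \<noteq> c \<Longrightarrow> a \<noteq> c \<Longrightarrow> cyc3 a b c = cyc3 b c a"
  by (auto simp: cyc3_def transpose_def fun_eq_iff)

lemma cyc3_inverse: "inv' (cyc3 a b c) = cyc3 c b a"
  by (simp add: cyc3_def o_inv_distrib transpose_commute)

lemma cyc3_apply: "a \<noteq> b \<Longrightarrow> b \<noteq> c \<Longrightarrow> a \<noteq> c \<Longrightarrow>
    cyc3 a b c v = (if v = a then b else if v = b then c else if v = c then a else v)"
  by (auto simp: cyc3_def transpose_def)

context thm411
begin

abbreviation "Gfull \<equiv> gen {r0, r1, r2, r3}"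

lemma Gfull_conj: "g \<in> Gfull \<Longrightarrow> x \<in> Gfull \<Longrightarrow> g \<circ> x \<circ> inv' g \<in> Gfull"
  using gen_comp gen_inv[OF subset_refl] by blast

lemma Gfull_conj_cyc3:
  assumes "g \<in> Gfull" "cyc3 a b c \<in> Gfull"
  shows "cyc3 (g a) (g b) (g c) \<in> Gfull"
  unfolding conj_cyc3[OF permutes_bij[OF gen_permutes[OF subset_refl assms(1)]], symmetric]
  by (rule Gfull_conj[OF assms])

section \<open>Spreading 3-cycles over the graph\<close>

definition full :: "nat set \<Rightarrow> bool" where
  "full T \<longleftrightarrow> (\<forall>a\<in>T. \<forall>b\<in>T. \<forall>c\<in>T. a \<noteq> b \<longrightarrow> b \<noteq> c \<longrightarrow> a \<noteq> c \<longrightarrow> cyc3 a b c \<in> Gfull)"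

text \<open>The 3-cycles through two fixed points generate all others by conjugation.\<close>

lemma full_if_two_points:
  assumes pq: "p \<noteq> q" and pqv: "\<And>v. v \<in> T \<Longrightarrow> v \<noteq> p \<Longrightarrow> v \<noteq> q \<Longrightarrow> cyc3 p q v \<in> Gfull"
  shows "full T"
proof -
  have rot: "cyc3 b c a \<in> Gfull" if "cyc3 a b c \<in> Gfull" "a \<noteq> b" "b \<noteq> c" "a \<noteq> c" for a b c
    using that cyc3_rotate by metis
  have inverse: "cyc3 c b a \<in> Gfull" if "cyc3 a b c \<in> Gfull" for a b c
    using gen_inv[OF subset_refl that] by (simp only: cyc3_inverse)
  \<comment> \<open>Conjugating \<open>cyc3 p q a\<close> by \<open>cyc3 p q b\<close> sends
    \<open>p\<close> to \<open>q\<close> and \<open>q\<close> to \<open>b\<close>. The facts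
    \<open>p\<close> and \<open>r\<close> below arise in the same way, so that all positions of
    \<open>p\<close> and \<open>q\<close> are covered.\<close>
  have q: "cyc3 q b a \<in> Gfull" if "a \<in> T - {p, q}" "b \<in> T - {p, q}" "a \<noteq> b" for a b
    using Gfull_conj_cyc3[of "cyc3 p q b" p q a] pqv[of a] pqv[of b] that pq by (simp add: cyc3_apply)
  have p: "cyc3 p b a \<in> Gfull" if "a \<in> T - {p, q}" "b \<in> T - {p, q}" "a \<noteq> b" for a b
  proof -
    have "cyc3 b q p \<in> Gfull" using inverse pqv[of b] that by blast
    then have "cyc3 b p a \<in> Gfull"
      using Gfull_conj_cyc3[of "cyc3 b q p" p q a] pqv[of a] that pq by (simp add: cyc3_apply)
    then have "cyc3 a p b \<in> Gfull" by (rule inverse)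
    then show ?thesis using rot[of a p b] that by auto
  qed
  have r: "cyc3 c b a \<in> Gfull" if "a \<in> T - {p, q}" "b \<in> T - {p, q}" "c \<in> T - {p, q}" "a \<noteq> b" "b \<noteq> c" "a \<noteq> c" for a b c
  proof -
    have "cyc3 p q c q = c" "cyc3 p q c b = b" "cyc3 p q c a = a"
      using that pq cyc3_apply[of p q c] by auto
    moreover have "cyc3 p q c \<in> Gfull" "cyc3 q b a \<in> Gfull" using pqv[of c] q[of a b] that by blast+
    ultimately show ?thesis using Gfull_conj_cyc3[of "cyc3 p q c" q b a] by simp
  qed
  have start_p: "cyc3 p b c \<in> Gfull" if "b \<in> T" "c \<in> T" "b \<noteq> c" "b \<noteq> p" "c \<noteq> p" for b c
  proof -
    have "cyc3 p b q \<in> Gfull" if "c = q"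
    proof -
      have "cyc3 b q p \<in> Gfull" using inverse pqv[of b] \<open>b \<in> T\<close> \<open>b \<noteq> c\<close> \<open>b \<noteq> p\<close> that by blast
      then show ?thesis using rot[of b q p] rot[of q p b] \<open>b \<noteq> c\<close> \<open>b \<noteq> p\<close> that pq by blast
    qed
    then show ?thesis using that pqv[of c] p[of c b] by blast
  qed
  have start_q: "cyc3 q b c \<in> Gfull" if "b \<in> T" "c \<in> T" "b \<noteq> c" "b \<noteq> q" "c \<noteq> q" "b \<noteq> p" "c \<noteq> p" for b c
    using that q[of c b] by blast
  show ?thesis
    unfolding full_def
  proof (intro ballI impI)
    fix a b c assume T: "a \<in> T" "b \<in> T" "c \<in> T" and ne: "a \<noteq> b" "b \<noteq> c" "a \<noteq> c"
    show "cyc3 a b c \<in> Gfull"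
    proof (cases "p \<in> {a, b, c}")
      case True
      then consider "a = p" | "b = p" | "c = p" by blast
      then show ?thesis
        by cases (use start_p[of b c] start_p[of c a] start_p[of a b] rot[of b c a] rot[of c a b] T ne in auto)
    next
      case False
      show ?thesis
      proof (cases "q \<in> {a, b, c}")
        case True
        then consider "a = q" | "b = q" | "c = q" by blast
        then show ?thesis
          by cases (use start_q[of b c] start_q[of c a] start_q[of a b] rot[of b c a] rot[of c a b] T ne False in auto)
      next
        case False2: False
        then show ?thesis using r[of c b a] T ne False by simp
      qed
    qed
  qed
qed

text \<open>Conjugation by \<open>g\<close> replaces the third point of \<open>cyc3 v w u\<close> by
  \<open>g u\<close>, so \<open>v\<close> and \<open>w\<close> can serve as the two fixed points for
  the larger set.\<close>

lemma full_insert: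
  assumes T: "full T" and g: "g \<in> Gfull"
    and uvw: "u \<in> T" "v \<in> T" "w \<in> T" "u \<noteq> v" "v \<noteq> w" "u \<noteq> w" "g v = v" "g w = w"
  shows "full (insert (g u) T)"
proof (rule full_if_two_points[OF \<open>v \<noteq> w\<close>])
  fix z assume z: "z \<in> insert (g u) T" "z \<noteq> v" "z \<noteq> w"
  have "cyc3 v w u \<in> Gfull" using T uvw unfolding full_def by metis
  then have "cyc3 v w (g u) \<in> Gfull" using Gfull_conj_cyc3[OF g, of v w u] uvw by simp
  then show "cyc3 v w z \<in> Gfull" using z T uvw unfolding full_def by (metis insert_iff)
qed

lemma Gfull_conj_transposes:
  assumes g: "g \<in> {r0, r1, r2, r3}" and t: "transpose a b \<circ> transpose c d \<in> Gfull"
  shows "transpose (g a) (g b) \<circ> transpose (g c) (g d) \<in> Gfull"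
proof -
  have G: "g \<in> Gfull" by (rule gen_incl[OF g])
  have bij: "bij g" by (rule permutes_bij[OF gen_permutes[OF subset_refl G]])
  have "g \<circ> (transpose a b \<circ> transpose c d) \<circ> inv' g
      = (g \<circ> transpose a b \<circ> inv' g) \<circ> (g \<circ> transpose c d \<circ> inv' g)"
    using bij by (simp add: fun_eq_iff bij_is_inj)
  then show ?thesis using Gfull_conj[OF G t] by (simp only: conj_transpose[OF bij])
qed

text \<open>Conjugates of \<open>\<rho>\<^sub>3\<close> in \<open>\<langle>\<rho>\<^sub>1, \<rho>\<^sub>2, \<rho>\<^sub>3\<rangle>\<close>. The fifth one differs from its conjugate by \<open>\<rho>\<^sub>0\<close> in a
  single transposition, which yields a 3-cycle.\<close>

lemma double_transposes:
  shows t1: "transpose (N + 5) (N + 9) \<circ> transpose (N + 6) (N + 10) \<in> Gfull"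
    and t2: "transpose (N + 4) (N + 8) \<circ> transpose (N + 7) (N + 11) \<in> Gfull"
    and t3: "transpose (N + 3) (N + 8) \<circ> transpose (N + 7) (N + 12) \<in> Gfull"
    and t4: "transpose (N + 2) (N + 9) \<circ> transpose (N + 6) (N + 13) \<in> Gfull"
    and t5: "transpose (N + 1) (N + 10) \<circ> transpose (N + 5) (N + 14) \<in> Gfull"
    and t6: "transpose (N + 1) (N + 11) \<circ> transpose (N + 4) (N + 14) \<in> Gfull"
    and t7: "transpose (N + 2) (N + 12) \<circ> transpose (N + 3) (N + 13) \<in> Gfull"
proof -
  have r: "r1 \<in> {r0, r1, r2, r3}" "r2 \<in> {r0, r1, r2, r3}" by simp_all
  show 1: "transpose (N + 5) (N + 9) \<circ> transpose (N + 6) (N + 10) \<in> Gfull"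
    using gen_incl[of r3 "{r0, r1, r2, r3}"] unfolding r3_def by simp
  note 2 = Gfull_conj_transposes[OF r(2) 1, unfolded r_values]
  note 3 = Gfull_conj_transposes[OF r(1) 2, unfolded r_values]
  note 4 = Gfull_conj_transposes[OF r(2) 3, unfolded r_values]
  note 5 = Gfull_conj_transposes[OF r(1) 4, unfolded r_values]
  note 6 = Gfull_conj_transposes[OF r(2) 5, unfolded r_values]
  note 7 = Gfull_conj_transposes[OF r(1) 6, unfolded r_values]
  show "transpose (N + 4) (N + 8) \<circ> transpose (N + 7) (N + 11) \<in> Gfull" using 2 .
  show "transpose (N + 3) (N + 8) \<circ> transpose (N + 7) (N + 12) \<in> Gfull" using 3 .
  show "transpose (N + 2) (N + 9) \<circ> transpose (N + 6) (N + 13) \<in> Gfull" using 4 .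
  show "transpose (N + 1) (N + 10) \<circ> transpose (N + 5) (N + 14) \<in> Gfull" using 5 .
  show "transpose (N + 1) (N + 11) \<circ> transpose (N + 4) (N + 14) \<in> Gfull" using 6 .
  show "transpose (N + 2) (N + 12) \<circ> transpose (N + 3) (N + 13) \<in> Gfull" using 7 .
qed

text \<open>Of the four points in \<open>t5\<close>, \<open>r0\<close> moves only
  \<open>N + 1\<close>, to \<open>N\<close>. The transposition of \<open>N + 5\<close> and
  \<open>N + 14\<close> therefore cancels in the product.\<close>

lemma cyc3_in_Gfull: "cyc3 (N + 1) (N + 10) N \<in> Gfull"
proof -
  have "r0 (N + 1) = N" by (simp add: r0_def)
  then have t: "transpose N (N + 10) \<circ> transpose (N + 5) (N + 14) \<in> Gfull"
    using Gfull_conj_transposes[OF _ t5, of r0] by (simp only: r_values insert_iff simp_thms)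
  have "cyc3 (N + 1) (N + 10) N = (transpose (N + 1) (N + 10) \<circ> transpose (N + 5) (N + 14)) \<circ>
      (transpose N (N + 10) \<circ> transpose (N + 5) (N + 14))"
    by (auto simp: cyc3_def transpose_def fun_eq_iff)
  then show ?thesis using gen_comp[OF t5 t] by simp
qed

lemma full_mono: "full T \<Longrightarrow> U \<subseteq> T \<Longrightarrow> full U"
  unfolding full_def by blast

text \<open>Each step uses a double transposition that sends a point already reached to a new one
  and fixes two other points already reached.\<close>

lemma full_block: "full {N..N + 14}"
proof -
  have "full {N, N + 1, N + 10}"
    by (rule full_if_two_points[of "N + 1" "N + 10"]) (use cyc3_in_Gfull in auto)
  then have "full (insert (N + 6) {N, N + 1, N + 10})"
    using full_insert[OF _ t1, of _ "N + 10" "N" "N + 1"] by (simp add: transpose_def)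
  then have "full (insert (N + 11) {N + 6, N, N + 1, N + 10})"
    using full_insert[OF _ t6, of _ "N + 1" "N + 6" "N"] by (simp add: transpose_def)
  then have "full (insert (N + 7) {N + 11, N + 6, N, N + 1, N + 10})"
    using full_insert[OF _ t2, of _ "N + 11" "N + 6" "N"] by (simp add: transpose_def)
  then have "full (insert (N + 12) {N + 7, N + 11, N + 6, N, N + 1, N + 10})"
    using full_insert[OF _ t3, of _ "N + 7" "N + 11" "N + 6"] by (simp add: transpose_def)
  then have "full (insert (N + 2) {N + 12, N + 7, N + 11, N + 6, N, N + 1, N + 10})"
    using full_insert[OF _ t7, of _ "N + 12" "N + 7" "N + 11"] by (simp add: transpose_def)
  then have "full (insert (N + 9) {N + 2, N + 12, N + 7, N + 11, N + 6, N, N + 1, N + 10})"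
    using full_insert[OF _ t4, of _ "N + 2" "N + 12" "N + 7"] by (simp add: transpose_def)
  then have "full (insert (N + 13) {N + 9, N + 2, N + 12, N + 7, N + 11, N + 6, N, N + 1, N + 10})"
    using full_insert[OF _ t4, of _ "N + 6" "N + 12" "N + 7"] by (simp add: transpose_def)
  then have "full (insert (N + 5) {N + 13, N + 9, N + 2, N + 12, N + 7, N + 11, N + 6, N, N + 1, N + 10})"
    using full_insert[OF _ t1, of _ "N + 9" "N + 13" "N + 2"] by (simp add: transpose_def)
  then have "full (insert (N + 14) {N + 5, N + 13, N + 9, N + 2, N + 12, N + 7, N + 11, N + 6, N, N + 1, N + 10})"
    using full_insert[OF _ t5, of _ "N + 5" "N + 13" "N + 9"] by (simp add: transpose_def)
  then have "full (insert (N + 4) {N + 14, N + 5, N + 13, N + 9, N + 2, N + 12, N + 7, N + 11, N + 6, N, N + 1, N + 10})"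
    using full_insert[OF _ t6, of _ "N + 14" "N + 5" "N + 13"] by (simp add: transpose_def)
  then have "full (insert (N + 8) {N + 4, N + 14, N + 5, N + 13, N + 9, N + 2, N + 12, N + 7, N + 11, N + 6, N, N + 1, N + 10})"
    using full_insert[OF _ t2, of _ "N + 4" "N + 14" "N + 5"] by (simp add: transpose_def)
  then have "full (insert (N + 3) {N + 8, N + 4, N + 14, N + 5, N + 13, N + 9, N + 2, N + 12, N + 7, N + 11, N + 6, N, N + 1, N + 10})"
    using full_insert[OF _ t7, of _ "N + 13" "N + 8" "N + 4"] by (simp add: transpose_def)
  then show ?thesis
  proof (rule full_mono)
    show "{N..N + 14} \<subseteq> insert (N + 3) {N + 8, N + 4, N + 14, N + 5, N + 13, N + 9, N + 2, N + 12, N + 7, N + 11, N + 6, N, N + 1, N + 10}"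
    proof
      fix v assume "v \<in> {N..N + 14}"
      then show "v \<in> insert (N + 3) {N + 8, N + 4, N + 14, N + 5, N + 13, N + 9, N + 2, N + 12, N + 7, N + 11, N + 6, N, N + 1, N + 10}"
        by (cases v rule: point_cases) auto
    qed
  qed
qed

text \<open>Walking down the path, the edge from \<open>Suc v\<close> to \<open>v\<close> has label
  0 or 1 according to the parity of \<open>v\<close>, and its generator adds
  \<open>v\<close>.\<close>

lemma full_tail:
  assumes "1 \<le> v" "v \<le> N"
  shows "full {v..N + 14}"
  using assms(2,1)
proof (induction v rule: inc_induct)
  case base
  show ?case by (rule full_block)
next
  case (step v)
  then have full: "full {Suc v..N + 14}" by simp
  define g where "g = (if odd v then r0 else r1)"
  have g: "g \<in> Gfull" unfolding g_def by (simp add: gen_incl)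
  have "g (Suc v) = v" using step by (auto simp: g_def r0_def r1_def)
  moreover have "full (insert (g (Suc v)) {Suc v..N + 14})"
  \<comment> \<open>The two fixed points depend on the generator: \<open>r1\<close> moves
    \<open>N + 10\<close> and \<open>N + 11\<close> but fixes \<open>N + 7\<close> and
    \<open>N + 8\<close>.\<close>
  proof (cases "odd v")
    case True
    then have "g (N + 10) = N + 10" "g (N + 11) = N + 11" by (simp_all only: g_def r_values if_True True simp_thms)
    then show ?thesis using step by (intro full_insert[OF full g, of _ "N + 10" "N + 11"]) auto
  next
    case False
    then have "g (N + 7) = N + 7" "g (N + 8) = N + 8" by (simp_all only: g_def r_values if_False False simp_thms)
    then show ?thesis using step by (intro full_insert[OF full g, of _ "N + 7" "N + 8"]) auto
  qed
  moreover have "insert v {Suc v..N + 14} = {v..N + 14}" using step by auto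
  ultimately show ?case by simp
qed

text \<open>Evenness of the generators gives one inclusion. The other holds because 3-cycles
  generate the alternating group and all of them lie in \<open>Gfull\<close>.\<close>

lemma Gfull_eq_alt_group: "Gfull = carrier (alt_group (N + 14))"
proof
  have "{r0, r1, r2, r3} \<subseteq> carrier (alt_group (N + 14))"
    using r_permutes r_evenperm by (simp add: alt_group_carrier)
  then show "Gfull \<subseteq> carrier (alt_group (N + 14))"
    by (rule group.generate_subgroup_incl[OF sym_group_is_group _ alt_group_is_subgroup])
  have full: "full {1..N + 14}" using full_tail[of 1] odd_N by simp
  have "three_cycles (N + 14) \<subseteq> Gfull"
  proof
    fix p assume "p \<in> three_cycles (N + 14)"
    then obtain cs where cs: "p = cycle_of_list cs" "cycle cs" "length cs = 3" "set cs \<subseteq> {1..N + 14}"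
      unfolding mem_Collect_eq by (elim exE conjE)
    obtain a b c where abc: "cs = [a, b, c]" by (rule that[OF stupid_lemma[OF cs(3)]])
    have "p = cyc3 a b c" unfolding cs(1) abc by (simp add: cyc3_def)
    moreover have "a \<in> {1..N + 14}" "b \<in> {1..N + 14}" "c \<in> {1..N + 14}" "a \<noteq> b" "b \<noteq> c" "a \<noteq> c"
      using cs(2,4) unfolding abc by simp_all
    ultimately show "p \<in> Gfull" using full unfolding full_def by blast
  qed
  then have incl: "generate (sym_group (N + 14)) (three_cycles (N + 14)) \<subseteq> Gfull"
    by (rule group.generate_subgroup_incl[OF sym_group_is_group _ gen_subgroup[OF subset_refl]])
  \<comment> \<open>Needed to pass from generation inside the alternating group to generation inside
    the symmetric group.\<close>
  have "(sym_group (N + 14))\<lparr>carrier := carrier (alt_group (N + 14))\<rparr> = alt_group (N + 14)"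
    by (simp add: alt_group_def)
  then have "generate (sym_group (N + 14)) (three_cycles (N + 14)) = carrier (alt_group (N + 14))"
    using group.generate_consistent[OF sym_group_is_group three_cycles_incl alt_group_is_subgroup, of "N + 14"]
    by (simp only: alt_group_carrier_as_three_cycles[symmetric])
  then show "carrier (alt_group (N + 14)) \<subseteq> Gfull" using incl by (simp only:)
qed

end

section \<open>The group is a string C-group\<close>

lemma funpow_eq_nat_pow:
  assumes "monoid G" "monoid.mult G = (\<circ>)" "monoid.one G = id"
  shows "x [^]\<^bsub>G\<^esub> (k :: nat) = x ^^ k"
  using assms(2,3) monoid.nat_pow_0[OF assms(1)] monoid.nat_pow_Suc[OF assms(1)]
  by (induction k) (simp_all add: funpow_Suc_right del: funpow.simps(2))

text \<open>The exponents that kill \<open>x\<close> are the multiples of its order, so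
  \<open>m\<close> and the order divide each other.\<close>

lemma (in group) ord_eqI:
  assumes "x \<in> carrier G" "\<And>k :: nat. x [^] k = \<one> \<longleftrightarrow> m dvd k"
  shows "ord x = m"
  using assms pow_eq_id by (metis dvd_antisym dvd_refl)

context thm411
begin

lemma rho_image:
  "\<rho> ` {..<4} = {r0, r1, r2, r3}" "\<rho> ` {0..1} = {r0, r1}" "\<rho> ` {1..2} = {r1, r2}"
  "\<rho> ` {2..3} = {r2, r3}" "\<rho> ` {0..2} = {r0, r1, r2}" "\<rho> ` {1..3} = {r1, r2, r3}"
proof -
  have sets: "{..<4} = {0, 1, 2, 3 :: nat}" "{0..1} = {0, 1 :: nat}" "{1..2} = {1, 2 :: nat}"
    "{2..3} = {2, 3 :: nat}" "{0..2} = {0, 1, 2 :: nat}" "{1..3} = {1, 2, 3 :: nat}" by auto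
  show "\<rho> ` {..<4} = {r0, r1, r2, r3}" "\<rho> ` {0..1} = {r0, r1}" "\<rho> ` {1..2} = {r1, r2}"
    "\<rho> ` {2..3} = {r2, r3}" "\<rho> ` {0..2} = {r0, r1, r2}" "\<rho> ` {1..3} = {r1, r2, r3}"
    by (simp_all only: sets image_insert image_empty rho_eq)
qed

abbreviation "G \<equiv> thm411_group (N + 14)"

text \<open>The two structures are equal, so the isomorphism asked for in the end is the
  identity.\<close>

lemma G_eq: "G = alt_group (N + 14)"
  using Gfull_eq_alt_group by (simp add: thm411_group_def rho_image alt_group_def)

lemma r_distinct: "r0 \<noteq> id" "r1 \<noteq> id" "r2 \<noteq> id" "r3 \<noteq> id" "r0 \<noteq> r1" "r1 \<noteq> r2" "r2 \<noteq> r3"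
proof -
  have "r0 (N + 2) = N + 3" "r1 (N + 2) = N + 1" "r1 (N + 5) = N + 6" "r2 (N + 2) = N + 3"
    "r2 (N + 5) = N + 4" "r3 (N + 5) = N + 9" by (rule r_values)+
  then show "r0 \<noteq> id" "r1 \<noteq> id" "r2 \<noteq> id" "r3 \<noteq> id" "r0 \<noteq> r1" "r1 \<noteq> r2" "r2 \<noteq> r3"
    by auto
qed

lemma gen_singleton:
  assumes "x \<in> gen {s}" "s \<in> {r0, r1, r2, r3}"
  shows "x = id \<or> x = s"
  using assms
proof (induction x rule: gen_induct)
  case (comp t x)
  then show ?case by (auto simp: fun_eq_iff)
qed (use assms(2) in auto)

interpretation S: group "sym_group (N + 14)"
  by (rule sym_group_is_group)

lemma rho_involution:
  assumes "i < 4"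
  shows "\<rho> i \<in> carrier (sym_group (N + 14)) \<and> \<rho> i \<otimes>\<^bsub>sym_group (N + 14)\<^esub> \<rho> i = \<one>\<^bsub>sym_group (N + 14)\<^esub>"
  using assms rho_image(1) by (intro r_involution_sym_group) blast

lemma rho_commute:
  assumes "i + 2 \<le> j" "j < 4"
  shows "\<rho> i \<circ> \<rho> j = \<rho> j \<circ> \<rho> i"
proof -
  consider "i = 0" "j = 2" | "i = 0" "j = 3" | "i = 1" "j = 3" using assms by linarith
  then show ?thesis using r_commute by cases (simp_all only: rho_eq)
qed

lemma intersection_property_step:
  assumes "l < u" "u < 4" "S.intersection_property \<rho> {l..<u}" "S.intersection_property \<rho> {l<..u}"
    "gen (\<rho> ` {l..<u}) \<inter> gen (\<rho> ` {l<..u}) \<subseteq> gen (\<rho> ` {l<..<u})"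
  shows "S.intersection_property \<rho> {l..u}"
proof (rule S.intersection_property_interval[OF assms(1) _ _ assms(3-5)])
  show "\<rho> i \<in> carrier (sym_group (N + 14)) \<and> \<rho> i \<otimes>\<^bsub>sym_group (N + 14)\<^esub> \<rho> i = \<one>\<^bsub>sym_group (N + 14)\<^esub>"
    if "i \<in> {l..u}" for i
    using that assms(2) by (intro rho_involution) simp
  show "\<rho> i \<otimes>\<^bsub>sym_group (N + 14)\<^esub> \<rho> j = \<rho> j \<otimes>\<^bsub>sym_group (N + 14)\<^esub> \<rho> i"
    if "i \<in> {l..u}" "j \<in> {l..u}" "i + 2 \<le> j" for i j
    unfolding sym_group_mult by (rule rho_commute) (use that assms(2) in simp_all)
qed

lemma intersection_property_G: "S.intersection_property \<rho> {..<4}"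
proof -
  have gen_Int: "gen {s} \<inter> gen {t} \<subseteq> gen {}" if "s \<in> {r0, r1, r2, r3}" "t \<in> {r0, r1, r2, r3}" "s \<noteq> t" for s t
  proof
    fix x assume "x \<in> gen {s} \<inter> gen {t}"
    then have "x = id \<or> x = s" "x = id \<or> x = t" using gen_singleton that(1,2) by blast+
    then have "x = id" using that(3) by auto
    then show "x \<in> gen {}" by (simp only: gen_id)
  qed
  \<comment> \<open>Rewrites the half-open intervals of the inductive criterion as the closed
    intervals of the preceding rank.\<close>
  have sets: "{0..<1} = {0 :: nat}" "{0<..1} = {1 :: nat}" "{0<..<1} = ({} :: nat set)"
    "{1..<2} = {1 :: nat}" "{1<..2} = {2 :: nat}" "{1<..<2} = ({} :: nat set)"
    "{2..<3} = {2 :: nat}" "{2<..3} = {3 :: nat}" "{2<..<3} = ({} :: nat set)"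
    "{0..<2} = {0..1 :: nat}" "{0<..2} = {1..2 :: nat}" "{0<..<2} = {1 :: nat}"
    "{1..<3} = {1..2 :: nat}" "{1<..3} = {2..3 :: nat}" "{1<..<3} = {2 :: nat}"
    "{0..<3} = {0..2 :: nat}" "{0<..3} = {1..3 :: nat}" "{0<..<3} = {1..2 :: nat}" "{..<4} = {0..3 :: nat}"
    by (simp_all add: set_eq_iff) presburger+
  have 01: "S.intersection_property \<rho> {0..1}"
  proof (rule intersection_property_step)
    show "gen (\<rho> ` {0..<1}) \<inter> gen (\<rho> ` {0<..1}) \<subseteq> gen (\<rho> ` {0<..<1})"
      unfolding sets image_insert image_empty rho_eq by (rule gen_Int) (simp_all add: r_distinct)
  qed (simp_all only: sets S.intersection_property_singleton)
  have 12: "S.intersection_property \<rho> {1..2}"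
  proof (rule intersection_property_step)
    show "gen (\<rho> ` {1..<2}) \<inter> gen (\<rho> ` {1<..2}) \<subseteq> gen (\<rho> ` {1<..<2})"
      unfolding sets image_insert image_empty rho_eq by (rule gen_Int) (simp_all add: r_distinct)
  qed (simp_all only: sets S.intersection_property_singleton)
  have 23: "S.intersection_property \<rho> {2..3}"
  proof (rule intersection_property_step)
    show "gen (\<rho> ` {2..<3}) \<inter> gen (\<rho> ` {2<..3}) \<subseteq> gen (\<rho> ` {2<..<3})"
      unfolding sets image_insert image_empty rho_eq by (rule gen_Int) (simp_all add: r_distinct)
  qed (simp_all only: sets S.intersection_property_singleton)
  have 012: "S.intersection_property \<rho> {0..2}"
  proof (rule intersection_property_step)
    show "gen (\<rho> ` {0..<2}) \<inter> gen (\<rho> ` {0<..2}) \<subseteq> gen (\<rho> ` {0<..<2})"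
      unfolding sets rho_image image_insert image_empty rho_eq using gen01_Int_gen12 by blast
  qed (simp_all only: sets 01 12)
  have 123: "S.intersection_property \<rho> {1..3}"
  proof (rule intersection_property_step)
    show "gen (\<rho> ` {1..<3}) \<inter> gen (\<rho> ` {1<..3}) \<subseteq> gen (\<rho> ` {1<..<3})"
      unfolding sets rho_image image_insert image_empty rho_eq using gen12_Int_gen23 by blast
  qed (simp_all only: sets 12 23)
  have "S.intersection_property \<rho> {0..3}"
  proof (rule intersection_property_step)
    show "gen (\<rho> ` {0..<3}) \<inter> gen (\<rho> ` {0<..3}) \<subseteq> gen (\<rho> ` {0<..<3})"
      unfolding sets rho_image using gen012_Int_gen123 by blast
  qed (simp_all only: sets 012 123)
  then show ?thesis by (simp only: sets)
qed

section \<open>Transfer from the symmetric group to the generated group\<close>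

text \<open>The intersections were computed in the symmetric group; generating inside the subgroup
  yields the same sets.\<close>

lemma generate_G:
  assumes "J \<subseteq> {..<4}"
  shows "generate G (\<rho> ` J) = gen (\<rho> ` J)"
proof -
  have "\<rho> ` J \<subseteq> Gfull" using assms rho_image(1) gen_incl by blast
  then show ?thesis
    unfolding thm411_group_def rho_image
    by (rule S.generate_consistent) (rule gen_subgroup, rule subset_refl)
qed

lemma mult_G: "monoid.mult G = (\<circ>)" "monoid.one G = id" "carrier G = Gfull"
  by (simp_all add: thm411_group_def rho_image sym_group_mult sym_group_one)

lemma G_pow: "x [^]\<^bsub>G\<^esub> (k :: nat) = x ^^ k"
  using funpow_eq_nat_pow[OF group.is_monoid mult_G(1,2)] G_eq alt_group_is_group by metis

lemma sggi_G: "sggi G 4 \<rho>"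
  unfolding sggi_def
proof (intro conjI allI impI)
  show "group G" unfolding G_eq by (rule alt_group_is_group)
  show "\<rho> i \<in> carrier G" if "i < 4" for i
    unfolding mult_G rho_image(1)[symmetric] using that by (intro gen_incl) simp
  show "\<rho> i \<noteq> \<one>\<^bsub>G\<^esub>" if "i < 4" for i
  proof -
    have "\<rho> i \<in> {r0, r1, r2, r3}" using that rho_image(1) by blast
    then show ?thesis unfolding mult_G using r_distinct(1-4) by (elim insertE emptyE) simp_all
  qed
  show inv: "\<rho> i \<otimes>\<^bsub>G\<^esub> \<rho> i = \<one>\<^bsub>G\<^esub>" if "i < 4" for i
    using rho_involution[OF that] unfolding mult_G sym_group_mult sym_group_one by blast
  show "generate G (\<rho> ` {..<4}) = carrier G"
    using generate_G[OF subset_refl] by (simp only: mult_G rho_image(1))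
  show "(\<rho> i \<otimes>\<^bsub>G\<^esub> \<rho> j) [^]\<^bsub>G\<^esub> (2::nat) = \<one>\<^bsub>G\<^esub>"
    if "i < 4" "j < 4" "i + 2 \<le> j \<or> j + 2 \<le> i" for i j
  proof -
    have comm: "\<rho> i \<circ> \<rho> j = \<rho> j \<circ> \<rho> i"
      using that(3) rho_commute[of i j] rho_commute[of j i] that(1,2) by (elim disjE) simp_all
    have "\<rho> i \<circ> \<rho> j \<circ> (\<rho> i \<circ> \<rho> j) = \<rho> i \<circ> (\<rho> j \<circ> \<rho> i) \<circ> \<rho> j" by (simp only: o_assoc)
    also have "\<dots> = (\<rho> i \<circ> \<rho> i) \<circ> (\<rho> j \<circ> \<rho> j)" by (simp only: comm[symmetric] o_assoc)
    also have "\<dots> = id" using inv[OF that(1)] inv[OF that(2)] unfolding mult_G by simp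
    finally show ?thesis unfolding G_pow mult_G by (simp only: numeral_2_eq_2 funpow.simps comp_id)
  qed
qed

lemma string_C_group_G: "string_C_group G 4 \<rho>"
  unfolding string_C_group_def
proof (intro conjI allI impI sggi_G)
  fix J K :: "nat set" assume JK: "J \<subseteq> {..<4}" "K \<subseteq> {..<4}"
  then have JK': "J \<inter> K \<subseteq> {..<4}" by blast
  have "gen (\<rho> ` J) \<inter> gen (\<rho> ` K) \<subseteq> gen (\<rho> ` (J \<inter> K))"
    using intersection_property_G JK unfolding S.intersection_property_def by blast
  moreover have "gen (\<rho> ` (J \<inter> K)) \<subseteq> gen (\<rho> ` J) \<inter> gen (\<rho> ` K)"
    using S.mono_generate[of "\<rho> ` (J \<inter> K)"] by blast
  ultimately show "generate G (\<rho> ` J) \<inter> generate G (\<rho> ` K) = generate G (\<rho> ` (J \<inter> K))"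
    unfolding generate_G[OF JK(1)] generate_G[OF JK(2)] generate_G[OF JK'] by (rule subset_antisym)
qed

lemma schlafli_type_G: "schlafli_type G 4 \<rho> = (if N = 1 then [10, 7, 4] else [2 * (N + 4), 14, 4])"
proof -
  interpret G: group G using G_eq alt_group_is_group by metis
  have car: "x \<circ> y \<in> carrier G" if "x \<in> {r0, r1, r2, r3}" "y \<in> {r0, r1, r2, r3}" for x y
    unfolding mult_G by (rule gen_comp[OF gen_incl[OF that(1)] gen_incl[OF that(2)]])
  have "G.ord (r0 \<circ> r1) = 2 * (N + 4)"
    by (rule G.ord_eqI[OF car]) (simp_all only: insert_iff simp_thms G_pow mult_G r0_r1_pow_eq_id)
  moreover have "G.ord (r1 \<circ> r2) = (if N = 1 then 7 else 14)"
    by (rule G.ord_eqI[OF car]) (simp_all only: insert_iff simp_thms G_pow mult_G r1_r2_pow_eq_id)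
  moreover have "G.ord (r2 \<circ> r3) = 4"
    by (rule G.ord_eqI[OF car]) (simp_all only: insert_iff simp_thms G_pow mult_G r2_r3_pow_eq_id)
  moreover have "[1..<4] = [1, 2, 3 :: nat]" by (simp add: upt_rec)
  ultimately show ?thesis
    unfolding schlafli_type_def by (simp add: mult_G rho_eq rho_eq(2)[simplified])
qed

end

theorem theorem4p11:
  fixes n :: nat
  assumes "n \<ge> 15" and "n mod 4 = 3"
  shows "thm411_group n \<cong> alt_group n
    \<and> string_C_group (thm411_group n) 4 (thm411_rho n)
    \<and> schlafli_type (thm411_group n) 4 (thm411_rho n)
        = (if n = 15 then [10, 7, 4] else [2 * (n - 10), 14, 4])"
proof -
  obtain N where n: "n = N + 14" using assms(1) that[of "n - 14"] by simp
  \<comment> \<open>As 14 is 2 modulo 4, the residue 3 of \<open>n\<close> becomes the residue 1 of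
    \<open>N\<close>.\<close>
  have "N mod 4 = 1" using assms(2) unfolding n by presburger
  then interpret thm411 N by unfold_locales
  have "thm411_group n \<cong> alt_group n"
    unfolding n G_eq by (rule iso_refl)
  moreover have "n - 10 = N + 4" "n = 15 \<longleftrightarrow> N = 1" by (simp_all add: n)
  ultimately show ?thesis
    using string_C_group_G schlafli_type_G unfolding n by (simp only: simp_thms)
qed

end
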